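(* Let $p\in\mathbb{C}[z_1,z_2]$ be a non-constant bivariate polynomial with $p(0,0)=1$, and let $n=(n_1,n_2)=\deg p$ be its bidegree. Then there exists a complex matrix $K$ of size $(n_1+n_2)\times(n_1+n_2)$ such that $$p(z_1,z_2)=\det\bigl(I_{|n|}-KZ_n\bigr)\qquad\text{and}\qquad \|K\|=s(p)^{-1},$$ where $|n|=n_1+n_2$ and $Z_n=z_1I_{n_1}\oplus z_2I_{n_2}$.
   Context: The bidegree of $p\in\mathbb{C}[z_1,z_2]$ is the pair $\deg p=(\deg_1 p,\deg_2 p)$ of its partial degrees in $z_1$ and $z_2$. $I_m$ is the $m\times m$ identity matrix, and $z_1I_{n_1}\oplus z_2I_{n_2}$ is the $(n_1+n_2)\times(n_1+n_2)$ diagonal matrix with $n_1$ diagonal entries $z_1$ followed by $n_2$ diagonal entries $z_2$ (a block is absent if its size is $0$). $\|K\|$ is the operator norm (largest singular value) of $K$. With $\mathbb{D}^2=\{(z_1,z_2)\in\mathbb{C}^2: |z_1|<1,\ |z_2|<1\}$, the stability radius of a non-constant polynomial $p$ with $p(0,0)=1$ is $$s(p)=\max\{r>0:\ p(z)\neq 0 \text{ for all } z\in r\mathbb{D}^2\}.$$ *)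

theory Defs
  imports
    "HOL-Analysis.L2_Norm"
    "HOL-Analysis.Product_Vector"
    "HOL-Computational_Algebra.Polynomial"
    "Jordan_Normal_Form.Matrix"
    "Jordan_Normal_Form.Determinant"
begin

text \<open>
  A polynomial in \<open>\<complex>[z\<^sub>1, z\<^sub>2]\<close> is an element of \<open>\<complex>[z\<^sub>1][z\<^sub>2]\<close>, of type \<open>complex poly poly\<close>:
  \<open>coeff (coeff p j) i\<close> is the coefficient of \<open>z\<^sub>1^i * z\<^sub>2^j\<close>, and the constant
  polynomials are those of the form \<open>[:[:c:]:]\<close>.
\<close>

definition bipoly :: "complex poly poly \<Rightarrow> complex \<Rightarrow> complex \<Rightarrow> complex" where
  "bipoly p z1 z2 = poly (poly p [:z2:]) z1"

lemma bipoly_altdef: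
  "bipoly p z1 z2 = (\<Sum>j\<le>degree p. \<Sum>i\<le>degree (coeff p j). coeff (coeff p j) i * z1 ^ i * z2 ^ j)"
proof -
  have "bipoly p z1 z2 = (\<Sum>j\<le>degree p. poly (coeff p j) z1 * z2 ^ j)"
    unfolding bipoly_def poly_altdef[of p] by (simp add: poly_sum poly_power)
  then show ?thesis
    by (simp add: poly_altdef sum_distrib_right)
qed

definition bidegree :: "complex poly poly \<Rightarrow> nat \<times> nat" where
  "bidegree p = (MAX j\<in>{..degree p}. degree (coeff p j), degree p)"

definition unit_bidisk :: "(complex \<times> complex) set" where
  "unit_bidisk = {(z1, z2). cmod z1 < 1 \<and> cmod z2 < 1}"

text \<open>The maximum is attained when \<open>p\<close> is non-constant and \<open>p(0,0) \<noteq> 0\<close>.\<close>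

definition stability_radius :: "complex poly poly \<Rightarrow> real" where
  "stability_radius p =
     (GREATEST r. r > 0 \<and> (\<forall>(z1, z2) \<in> (\<lambda>z. r *\<^sub>R z) ` unit_bidisk. bipoly p z1 z2 \<noteq> 0))"

definition Z_mat :: "nat \<Rightarrow> nat \<Rightarrow> complex \<Rightarrow> complex \<Rightarrow> complex mat" where
  "Z_mat n1 n2 z1 z2 = diag_block_mat [z1 \<cdot>\<^sub>m 1\<^sub>m n1, z2 \<cdot>\<^sub>m 1\<^sub>m n2]"

definition euclidean_norm :: "complex vec \<Rightarrow> real" where
  "euclidean_norm v = L2_set (\<lambda>i. cmod (v $ i)) {..<dim_vec v}"

definition mat_op_norm :: "complex mat \<Rightarrow> real" where
  "mat_op_norm A =
     (SUP v\<in>{v \<in> carrier_vec (dim_col A). euclidean_norm v \<le> 1}. euclidean_norm (A *\<^sub>v v))"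

end

theory Submission
  imports
    Defs
    "HOL-Library.Poly_Mapping"
    "HOL-Complex_Analysis.Cauchy_Integral_Formula"
    "HOL-Computational_Algebra.Field_as_Ring"
    "HOL-Computational_Algebra.Fundamental_Theorem_Algebra"
    "HOL-Computational_Algebra.Polynomial_Factorial"
begin

text \<open>
  Let \<open>p\<close> have no zeros on the closed bidisk, let \<open>p\<^sup>~\<close> be its reversal, and give the Laurent
  polynomials the inner product of \<open>L\<^sup>2(1/|p|\<^sup>2)\<close> on the torus. Then \<open>p\<close> is orthogonal to all
  monomials in the half plane \<open>j > 0\<close> or \<open>j = 0, i > 0\<close>. Write \<open>P(a,b)\<close> for the
  polynomials of bidegree at most \<open>(a,b)\<close>. The decisive fact, due to Geronimo and Woerdeman,
  is that the orthogonal complements of \<open>P(n\<^sub>1-1,n\<^sub>2-1)\<close> in \<open>P(n\<^sub>1-1,n\<^sub>2)\<close> and in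
  \<open>P(n\<^sub>1,n\<^sub>2-1)\<close> are orthogonal to each other. With \<open>F\<close> the first of these and \<open>G\<close> the complement
  of \<open>z\<^sub>1 P(n\<^sub>1-1,n\<^sub>2-1)\<close> in \<open>P(n\<^sub>1,n\<^sub>2-1)\<close>, it yields two orthogonal decompositions
  \<open>\<langle>p\<^sup>~\<rangle> + F + G = \<langle>p\<rangle> + z\<^sub>1 F + z\<^sub>2 G\<close> of one space, where \<open>dim F = n\<^sub>1\<close> and \<open>dim G = n\<^sub>2\<close>.
  The compression \<open>K\<close> of the change of basis is a contraction, \<open>p\<close> divides \<open>p\<^sup>~ det(I - KZ)\<close>, and
  comparing degrees on the slices \<open>|z\<^sub>1| = 1\<close> and \<open>|z\<^sub>2| = 1\<close> gives \<open>p = det(I - KZ)\<close>.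
  A general \<open>p\<close> is reached by dilation and compactness of the set of contractions. If the
  norm of \<open>K\<close> were smaller than \<open>1/s(p)\<close>, then \<open>det(I - KZ)\<close> would not vanish on a bigger
  bidisk.
\<close>

text \<open>The common space of the two decompositions is the orthogonal complement of z1
  P(n1-1,n2-1) in P(n1,n2), of dimension n1+n2+1; this is why G is taken relative to z1 P(n1-1,n2-1)
  and F relative to P(n1-1,n2-1). The obstacle is the decisive orthogonality: it concerns finite
  boxes, but its proof passes through a strip infinite in z1. No completed Hilbert space is formed.
  Orthogonality of g to a box first spreads to all lower powers of z1: the monomials of the strip
  have a dual basis of Laurent polynomials of bounded z1-width, so the error of a finite truncation
  sits at the far end of the strip, where the moments of g tend to 0. Then the numbers <z1^(-m) f,
  g> satisfy a linear recurrence whose characteristic polynomial is p(z1,0) with conjugated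
  coefficients; its roots lie outside the closed disk, so a bounded solution is 0. The form enters
  this argument only through axioms on Laurent polynomials; integrals appear when these axioms are
  verified.\<close>

unbundle no vec_syntax
hide_const (open) Finite_Cartesian_Product.mat Finite_Cartesian_Product.vec

section \<open>Laurent polynomials in two variables\<close>

type_synonym laurent = "(int \<times> int) \<Rightarrow>\<^sub>0 complex"

abbreviation lookup :: "laurent \<Rightarrow> int \<times> int \<Rightarrow> complex" where
  "lookup \<equiv> Poly_Mapping.lookup"

abbreviation keys :: "laurent \<Rightarrow> (int \<times> int) set" where
  "keys \<equiv> Poly_Mapping.keys"

abbreviation single :: "int \<times> int \<Rightarrow> complex \<Rightarrow> laurent" where
  "single \<equiv> Poly_Mapping.single"

abbreviation const :: "complex \<Rightarrow> laurent" where
  "const c \<equiv> single 0 c"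

abbreviation zpow :: "int \<Rightarrow> int \<Rightarrow> laurent" where
  "zpow i j \<equiv> single (i, j) 1"

lemma sum_monomials:
  fixes x :: laurent
  assumes "finite S" "keys x \<subseteq> S"
  shows "x = (\<Sum>a\<in>S. single a (lookup x a))"
proof (rule poly_mapping_eqI)
  fix k
  have "lookup (\<Sum>a\<in>S. single a (lookup x a)) k
      = (\<Sum>a\<in>S. if a = k then lookup x k else 0)"
    unfolding lookup_sum by (intro sum.cong) (auto simp: lookup_single when_def)
  also have "\<dots> = lookup x k"
    using assms by (auto simp: not_in_keys_iff_lookup_eq_zero)
  finally show "lookup x k = lookup (\<Sum>a\<in>S. single a (lookup x a)) k" ..
qed

lemma laurent_induct [case_names single add]:
  fixes x :: laurent
  assumes single_c: "\<And>a c. P (single a c)" and add: "\<And>x y. P x \<Longrightarrow> P y \<Longrightarrow> P (x + y)"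
  shows "P x"
proof -
  have P0: "P 0" using single_c[of 0 0] by simp
  have "P (\<Sum>a\<in>S. single a (lookup x a))" if "finite S" for S
    using that by (induction S) (auto intro: single_c add P0)
  from this[of "keys x"] show ?thesis
    using sum_monomials[of "keys x" x] by simp
qed

lemma lookup_mult_single:
  "lookup (x * single b c) a = lookup (x :: laurent) (a - b) * c"
proof (induction x rule: laurent_induct)
  case (single d e)
  then show ?case
    by (auto simp: mult_single lookup_single when_def)
next
  case (add x y)
  then show ?case by (simp add: lookup_add algebra_simps)
qed

lemma lookup_const_mult [simp]: "lookup (const c * x) a = c * lookup (x :: laurent) a"
  using lookup_mult_single[of x 0 c a] by (simp add: mult.commute)

lemma const_mult_const: "const c * const d = const (c * d)"
  by (simp add: mult_single)

lemma const_add: "const (c + d) = const c + const d"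
  by (simp add: single_add)

lemma lookup_zpow_mult [simp]: "lookup (zpow i j * x) (k, l) = lookup (x :: laurent) (k - i, l - j)"
  using lookup_mult_single[of x "(i, j)" 1 "(k, l)"] by (simp add: mult.commute)

lemma zpow_mult: "zpow i j * zpow k l = zpow (i + k) (j + l)"
  by (simp add: mult_single)

lemma zpow_0: "zpow 0 0 = 1"
  by (metis single_one zero_prod_def)

lemma keys_mult_D:
  fixes x :: laurent
  assumes "a \<in> keys (x * y)"
  obtains b c where "b \<in> keys x" "c \<in> keys y" "a = b + c"
  using keys_mult[of x y] assms by auto

lemma keys_zpow_mult: "(k, l) \<in> keys (zpow i j * x) \<longleftrightarrow> (k - i, l - j) \<in> keys (x :: laurent)"
  by (simp add: in_keys_iff)

lemma keys_const_mult: "keys (const c * x) \<subseteq> keys (x :: laurent)"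
  by (auto simp: in_keys_iff)

lemma keys_sum_subset:
  fixes f :: "'a \<Rightarrow> laurent"
  assumes "\<And>i. i \<in> I \<Longrightarrow> keys (f i) \<subseteq> S"
  shows "keys (sum f I) \<subseteq> S"
  using assms keys_sum[of f I] by fastforce

lemma keys_diff_subset: "keys x \<subseteq> S \<Longrightarrow> keys y \<subseteq> S \<Longrightarrow> keys (x - y) \<subseteq> (S :: (int \<times> int) set)"
  for x y :: laurent
  using keys_diff[of x y] by blast

lemma keys_const_mult_subset: "keys x \<subseteq> S \<Longrightarrow> keys (const c * x) \<subseteq> S"
  for x :: laurent
  using keys_const_mult by blast

text \<open>On the torus z^(-a) is the conjugate of z^a, so this is pointwise complex conjugation
  there.\<close>

lift_definition star :: "laurent \<Rightarrow> laurent" is "\<lambda>x a. cnj (x (- a))"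
proof -
  fix f :: "int \<times> int \<Rightarrow> complex"
  assume *: "finite {x. f x \<noteq> 0}"
  have "{a. cnj (f (- a)) \<noteq> 0} = uminus ` {x. f x \<noteq> 0}"
    by (force simp: image_iff)
  then show "finite {a. cnj (f (- a)) \<noteq> 0}" using * by simp
qed

lemma lookup_star [simp]: "lookup (star x) a = cnj (lookup x (- a))"
  by transfer simp

lemma star_add: "star (x + y) = star x + star y"
  by (rule poly_mapping_eqI) (simp add: lookup_add)

lemma star_diff: "star (x - y) = star x - star y"
  by (rule poly_mapping_eqI) (simp add: lookup_minus)

lemma star_zero [simp]: "star 0 = 0"
  by (rule poly_mapping_eqI) simp

lemma star_star [simp]: "star (star x) = x"
  by (rule poly_mapping_eqI) simp

lemma star_sum: "star (sum f A) = (\<Sum>a\<in>A. star (f a))"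
  by (induction A rule: infinite_finite_induct) (auto simp: star_add)

lemma star_single [simp]: "star (single a c) = Poly_Mapping.single (- a) (cnj c)"
  by (rule poly_mapping_eqI) (auto simp: lookup_single when_def minus_equation_iff)

lemma star_mult: "star (x * y) = star x * star y"
proof (induction x rule: laurent_induct)
  case (single a c)
  show ?case
  proof (induction y rule: laurent_induct)
    case (single b d)
    then show ?case by (simp add: mult_single)
  next
    case (add x y)
    then show ?case by (simp add: star_add algebra_simps)
  qed
next
  case (add x y)
  then show ?case by (simp add: star_add algebra_simps)
qed

lemma keys_star: "a \<in> keys (star x) \<longleftrightarrow> - a \<in> keys x"
  by (simp add: in_keys_iff)

text \<open>By Parseval this is the squared norm in the unweighted L2 space of the torus, the
  reference against which weighted forms are compared.\<close>

definition nrm2 :: "laurent \<Rightarrow> real" where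
  "nrm2 x = (\<Sum>a\<in>keys x. (cmod (lookup x a))\<^sup>2)"

lemma nrm2_eq:
  assumes "finite S" "keys x \<subseteq> S"
  shows "nrm2 x = (\<Sum>a\<in>S. (cmod (lookup x a))\<^sup>2)"
  unfolding nrm2_def using assms
  by (intro sum.mono_neutral_left) (auto simp: not_in_keys_iff_lookup_eq_zero)

lemma nrm2_nonneg: "nrm2 x \<ge> 0"
  unfolding nrm2_def by (intro sum_nonneg) auto

lemma lookup_le_nrm2: "(cmod (lookup x a))\<^sup>2 \<le> nrm2 x"
proof (cases "a \<in> keys x")
  case True
  then show ?thesis
    unfolding nrm2_def using member_le_sum[of a "keys x" "\<lambda>a. (cmod (lookup x a))\<^sup>2"] by simp
next
  case False
  then show ?thesis using nrm2_nonneg[of x] by (simp add: not_in_keys_iff_lookup_eq_zero)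
qed

lemma nrm2_eq_0: "nrm2 x = 0 \<longleftrightarrow> x = 0"
proof
  assume "nrm2 x = 0"
  then have "lookup x a = 0" for a using lookup_le_nrm2[of x a] by simp
  then show "x = 0" by (intro poly_mapping_eqI) simp
qed (simp add: nrm2_def)

lemma lookup_mult_star_0:
  assumes "finite S" "keys x \<subseteq> S"
  shows "lookup (y * star x) 0 = (\<Sum>a\<in>S. lookup y a * cnj (lookup x a))"
proof -
  have "lookup (y * star x) 0 = lookup (y * star (\<Sum>a\<in>S. single a (lookup x a))) 0"
    using sum_monomials[OF assms] by simp
  also have "\<dots> = (\<Sum>a\<in>S. lookup y a * cnj (lookup x a))"
    by (simp add: star_sum sum_distrib_left lookup_sum lookup_mult_single)
  finally show ?thesis .
qed

lemma lookup_mult_star_self: "lookup (x * star x) 0 = complex_of_real (nrm2 x)"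
  by (subst lookup_mult_star_0[of "keys x"])
     (auto simp: nrm2_def complex_norm_square intro!: sum.cong simp flip: of_real_power)

lift_definition cut :: "int \<Rightarrow> laurent \<Rightarrow> laurent" is "\<lambda>k x a. if snd a \<le> k then x a else 0"
  by (rule finite_subset[rotated]) auto

lemma lookup_cut [simp]: "lookup (cut k x) a = (if snd a \<le> k then lookup x a else 0)"
  by transfer simp

lemma keys_cut: "keys (cut k x) = {a \<in> keys x. snd a \<le> k}"
  by (auto simp: in_keys_iff split: if_splits)

lemma keys_minus_cut: "keys (x - cut k x) = {a \<in> keys x. snd a > k}"
  by (auto simp: in_keys_iff lookup_minus split: if_splits)

text \<open>With \<open>powi\<close>, negative powers of 0 are 0 and \<open>0 powi 0\<close> is 1.
  Evaluation at 0 is therefore correct for polynomials, while multiplicativity on all Laurent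
  polynomials holds only at nonzero points.\<close>

definition ev :: "complex \<Rightarrow> complex \<Rightarrow> laurent \<Rightarrow> complex" where
  "ev z w x = (\<Sum>a\<in>keys x. lookup x a * (z powi fst a * w powi snd a))"

lemma ev_eq:
  assumes "finite S" "keys x \<subseteq> S"
  shows "ev z w x = (\<Sum>a\<in>S. lookup x a * (z powi fst a * w powi snd a))"
  unfolding ev_def using assms
  by (intro sum.mono_neutral_left) (auto simp: not_in_keys_iff_lookup_eq_zero)

lemma ev_add: "ev z w (x + y) = ev z w x + ev z w y"
  using keys_add[of x y]
  by (subst (1 2 3) ev_eq[of "keys x \<union> keys y"]) (auto simp: lookup_add algebra_simps sum.distrib)

lemma ev_zero [simp]: "ev z w 0 = 0"
  by (simp add: ev_def)

lemma ev_sum: "ev z w (sum f A) = (\<Sum>a\<in>A. ev z w (f a))"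
  by (induction A rule: infinite_finite_induct) (auto simp: ev_add)

lemma ev_single: "ev z w (single a c) = c * (z powi fst a * w powi snd a)"
  by (subst ev_eq[of "{a}"]) auto

lemma ev_const [simp]: "ev z w (const c) = c"
  by (simp add: ev_single)

lemma ev_mult:
  assumes "z \<noteq> 0" "w \<noteq> 0"
  shows "ev z w (x * y) = ev z w x * ev z w y"
proof (induction x rule: laurent_induct)
  case (single a c)
  show ?case
  proof (induction y rule: laurent_induct)
    case (single b d)
    then show ?case using assms by (simp add: mult_single ev_single power_int_add)
  next
    case (add x y)
    then show ?case by (simp add: ev_add algebra_simps)
  qed
next
  case (add x y)
  then show ?case by (simp add: ev_add algebra_simps)
qed

lemma cnj_power_int: "cnj (z powi k) = cnj z powi k"
  by (cases k rule: int_cases) (auto simp: power_int_def)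

lemma ev_star: "ev z w (star x) = cnj (ev (inverse (cnj z)) (inverse (cnj w)) x)"
  by (induction x rule: laurent_induct)
     (simp_all add: ev_add star_add ev_single cnj_power_int power_int_minus power_int_inverse)

lemma ev_star_torus:
  assumes "cmod z = 1" "cmod w = 1"
  shows "ev z w (star x) = cnj (ev z w x)"
proof -
  have "inverse (cnj u) = u" if "cmod u = 1" for u
    using that complex_norm_square[of u] by (metis inverse_unique mult.commute of_real_1 power_one)
  then show ?thesis using assms by (simp add: ev_star)
qed

section \<open>Orthonormal families of Laurent polynomials\<close>

text \<open>The lower bound gives definiteness and controls coefficients by the norm; the upper
  bound makes the moments of a fixed element square-summable.\<close>

locale laurent_form =
  fixes L :: "laurent \<Rightarrow> complex" and dl Cu :: real
  assumes L_add: "L (x + y) = L x + L y"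
    and L_const: "L (const c * x) = c * L x"
    and L_star: "L (star x) = cnj (L x)"
    and dl_pos: "dl > 0"
    and L_lower: "dl * nrm2 x \<le> Re (L (x * star x))"
    and L_upper: "Re (L (x * star x)) \<le> Cu * nrm2 x"
begin

definition ip :: "laurent \<Rightarrow> laurent \<Rightarrow> complex" where
  "ip x y = L (x * star y)"

definition nm :: "laurent \<Rightarrow> real" where
  "nm x = Re (ip x x)"

lemma L_zero [simp]: "L 0 = 0"
  using L_const[of 0 0] by simp

lemma ip_cnj: "ip y x = cnj (ip x y)"
  unfolding ip_def by (simp add: L_star[symmetric] star_mult mult.commute)

lemma ip_add_left: "ip (x + y) z = ip x z + ip y z"
  unfolding ip_def by (simp add: L_add algebra_simps)

lemma ip_const_left: "ip (const c * x) z = c * ip x z"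
  unfolding ip_def by (simp add: L_const mult.assoc)

lemma ip_add_right: "ip z (x + y) = ip z x + ip z y"
  using ip_cnj ip_add_left by (metis complex_cnj_add)

lemma ip_const_right: "ip z (const c * x) = cnj c * ip z x"
  using ip_cnj ip_const_left by (metis complex_cnj_mult)

lemma ip_zero_left [simp]: "ip 0 z = 0"
  by (simp add: ip_def)

lemma ip_zero_right [simp]: "ip z 0 = 0"
  by (simp add: ip_def)

lemma ip_diff_left: "ip (x - y) z = ip x z - ip y z"
  using ip_add_left[of "x - y" y z] by simp

lemma ip_diff_right: "ip z (x - y) = ip z x - ip z y"
  using ip_add_right[of z "x - y" y] by simp

lemma ip_sum_left: "ip (sum f A) z = (\<Sum>a\<in>A. ip (f a) z)"
  by (induction A rule: infinite_finite_induct) (auto simp: ip_add_left)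

lemma ip_sum_right: "ip z (sum f A) = (\<Sum>a\<in>A. ip z (f a))"
  by (induction A rule: infinite_finite_induct) (auto simp: ip_add_right)

lemma zpow_star: "zpow i j * star (zpow i j) = 1"
  by (simp add: zpow_mult zpow_0)

lemma ip_zpow: "ip (zpow i j * x) (zpow i j * y) = ip x y"
proof -
  have "zpow i j * x * star (zpow i j * y) = (zpow i j * star (zpow i j)) * (x * star y)"
    by (simp add: star_mult mult_ac del: star_single)
  then show ?thesis by (simp add: ip_def zpow_star del: star_single)
qed

lemma ip_self: "ip x x = complex_of_real (nm x)"
proof -
  have "Im (ip x x) = 0" using ip_cnj[of x x] by (simp add: complex_eq_iff)
  then show ?thesis by (simp add: nm_def complex_eq_iff)
qed

lemma nm_lower: "dl * nrm2 x \<le> nm x"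
  using L_lower by (simp add: nm_def ip_def)

lemma nm_upper: "nm x \<le> Cu * nrm2 x"
  using L_upper by (simp add: nm_def ip_def)

lemma nm_nonneg: "nm x \<ge> 0"
  using nm_lower[of x] nrm2_nonneg[of x] dl_pos by (smt (verit) mult_nonneg_nonneg)

lemma nm_eq_0: "nm x = 0 \<longleftrightarrow> x = 0"
proof
  assume "nm x = 0"
  then have "dl * nrm2 x \<le> 0" using nm_lower[of x] by simp
  then have "nrm2 x = 0" using dl_pos nrm2_nonneg[of x] by (smt (verit) mult_pos_pos)
  then show "x = 0" by (simp add: nrm2_eq_0)
qed (simp add: nm_def)

section \<open>Orthonormal families: projection, Bessel, Parseval, completeness\<close>

definition orthonormal :: "('i \<Rightarrow> laurent) \<Rightarrow> 'i set \<Rightarrow> bool" where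
  "orthonormal e S \<longleftrightarrow> (\<forall>a\<in>S. \<forall>b\<in>S. ip (e a) (e b) = (if a = b then 1 else 0))"

definition proj :: "('i \<Rightarrow> laurent) \<Rightarrow> 'i set \<Rightarrow> laurent \<Rightarrow> laurent" where
  "proj e S x = (\<Sum>a\<in>S. const (ip x (e a)) * e a)"

lemma proj_add: "proj e S (x + y) = proj e S x + proj e S y"
  by (simp add: proj_def ip_add_left const_add algebra_simps sum.distrib)

lemma proj_const: "proj e S (const c * x) = const c * proj e S x"
  by (simp add: proj_def ip_const_left sum_distrib_left mult.assoc flip: const_mult_const)

lemma proj_sum: "proj e S (sum f A) = (\<Sum>a\<in>A. proj e S (f a))"
  by (induction A rule: infinite_finite_induct) (auto simp: proj_add, auto simp: proj_def)

lemma ip_proj: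
  assumes "finite S" "orthonormal e S" "b \<in> S"
  shows "ip (proj e S x) (e b) = ip x (e b)"
proof -
  have "ip (proj e S x) (e b) = (\<Sum>a\<in>S. if a = b then ip x (e b) else 0)"
    unfolding proj_def ip_sum_left
    using assms by (intro sum.cong) (auto simp: ip_const_left orthonormal_def)
  then show ?thesis using assms by simp
qed

text \<open>The residual is orthogonal to the projection, so this is Pythagoras; Bessel and Parseval
  are read off from it.\<close>

lemma nm_residual:
  assumes "finite S" "orthonormal e S"
  shows "nm (x - proj e S x) = nm x - (\<Sum>a\<in>S. (cmod (ip x (e a)))\<^sup>2)"
proof -
  have orth: "ip (x - proj e S x) (proj e S x) = 0"
    by (subst (2) proj_def)
       (simp add: ip_sum_right ip_const_right ip_diff_left ip_proj assms)
  have "ip (x - proj e S x) (x - proj e S x) = ip x x - ip (proj e S x) x"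
    using orth ip_diff_right[of "x - proj e S x" x "proj e S x"]
    by (simp only: ip_diff_left diff_zero)
  also have "ip (proj e S x) x = (\<Sum>a\<in>S. ip x (e a) * cnj (ip x (e a)))"
    unfolding proj_def by (simp add: ip_sum_left ip_const_left flip: ip_cnj)
  also have "\<dots> = complex_of_real (\<Sum>a\<in>S. (cmod (ip x (e a)))\<^sup>2)"
    by (simp add: complex_norm_square flip: of_real_power)
  finally have "complex_of_real (nm (x - proj e S x)) = complex_of_real (nm x - (\<Sum>a\<in>S. (cmod (ip x (e a)))\<^sup>2))"
    by (simp only: ip_self of_real_diff)
  then show ?thesis by (simp only: of_real_eq_iff)
qed

lemma bessel:
  assumes "finite S" "orthonormal e S"
  shows "(\<Sum>a\<in>S. (cmod (ip x (e a)))\<^sup>2) \<le> nm x"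
  using nm_residual[OF assms, of x] nm_nonneg[of "x - proj e S x"] by simp

lemma nm_const: "nm (const c * x) = (cmod c)\<^sup>2 * nm x"
proof -
  have "ip (const c * x) (const c * x) = (c * cnj c) * ip x x"
    by (simp add: ip_const_left ip_const_right)
  also have "\<dots> = complex_of_real ((cmod c)\<^sup>2 * nm x)"
    by (simp only: ip_self complex_norm_square of_real_mult)
  finally have "ip (const c * x) (const c * x) = complex_of_real ((cmod c)\<^sup>2 * nm x)" .
  then show ?thesis by (metis ip_self of_real_eq_iff)
qed

text \<open>Bessel's inequality for the one-element family consisting of the normalised
  \<open>y\<close>.\<close>

lemma cauchy_schwarz: "(cmod (ip x y))\<^sup>2 \<le> nm x * nm y"
proof (cases "y = 0")
  case False
  define c where "c = complex_of_real (1 / sqrt (nm y))"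
  have pos: "nm y > 0" using False nm_nonneg[of y] nm_eq_0[of y] by simp
  have c2: "(cmod c)\<^sup>2 = 1 / nm y" using pos by (simp add: c_def norm_divide power_divide)
  have "nm (const c * y) = 1" using pos by (simp add: nm_const c2)
  then have "orthonormal (\<lambda>_. const c * y) {()}" by (simp add: orthonormal_def ip_self)
  from bessel[OF _ this, of x] have "(cmod (ip x (const c * y)))\<^sup>2 \<le> nm x" by simp
  then have "(cmod c)\<^sup>2 * (cmod (ip x y))\<^sup>2 \<le> nm x"
    by (simp only: ip_const_right norm_mult power_mult_distrib complex_mod_cnj)
  then show ?thesis using pos by (simp add: c2 field_simps)
qed (simp add: nm_def)

text \<open>Indexing the basis by the exponents themselves turns dimension counts into cardinalities
  of sets of exponents.\<close>

definition onb :: "(int \<times> int \<Rightarrow> laurent) \<Rightarrow> (int \<times> int) set \<Rightarrow> bool" where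
  "onb e S \<longleftrightarrow> (\<forall>a\<in>S. keys (e a) \<subseteq> S) \<and> orthonormal e S \<and> (\<forall>x. keys x \<subseteq> S \<longrightarrow> proj e S x = x)"

lemma keys_proj: "(\<And>a. a \<in> S \<Longrightarrow> keys (e a) \<subseteq> T) \<Longrightarrow> keys (proj e S x) \<subseteq> T"
  unfolding proj_def by (intro keys_sum_subset keys_const_mult_subset) auto

text \<open>One Gram-Schmidt step. The residual \<open>r\<close> of the new monomial has coefficient
  1 at \<open>d\<close>, hence is nonzero and can be normalised.\<close>

lemma onb_insert:
  assumes S: "finite S" and d: "d \<notin> S" and e: "onb e S"
  shows "\<exists>e'. onb e' (insert d S) \<and> (\<forall>a\<in>S. e' a = e a)"
proof -
  define r where "r = single d 1 - proj e S (single d 1)"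
  have orth: "orthonormal e S" and ke: "\<And>a. a \<in> S \<Longrightarrow> keys (e a) \<subseteq> S"
    and comp: "\<And>x. keys x \<subseteq> S \<Longrightarrow> proj e S x = x"
    using e by (auto simp: onb_def)
  have kp: "keys (proj e S y) \<subseteq> S" for y using ke by (rule keys_proj)
  have rd: "lookup r d = 1"
    using kp[of "single d 1"] d by (auto simp: r_def lookup_minus not_in_keys_iff_lookup_eq_zero)
  have kr: "keys r \<subseteq> insert d S"
    unfolding r_def using kp[of "single d 1"] by (intro keys_diff_subset) auto
  have ro: "ip r (e a) = 0" if "a \<in> S" for a
    unfolding r_def by (simp add: ip_diff_left ip_proj[OF S orth that])
  have "r \<noteq> 0" using rd by auto
  then have pos: "nm r > 0" using nm_nonneg[of r] nm_eq_0[of r] by simp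
  define c where "c = complex_of_real (1 / sqrt (nm r))"
  have c0: "c \<noteq> 0" and c2: "(cmod c)\<^sup>2 = 1 / nm r"
    using pos by (auto simp: c_def norm_divide power_divide)
  define e' where "e' = e(d := const c * r)"
  have e'S: "\<forall>a\<in>S. e' a = e a" using d by (auto simp: e'_def)
  have o1: "ip (e' d) (e' d) = 1" using pos by (simp add: e'_def ip_self nm_const c2)
  have o2: "ip (e' d) (e a) = 0" "ip (e a) (e' d) = 0" if "a \<in> S" for a
    using ro[OF that] ip_cnj[of "e a" r] by (auto simp: e'_def ip_const_left ip_const_right)
  have orth': "orthonormal e' (insert d S)"
    using orth o1 o2 e'S d unfolding orthonormal_def by auto
  have projeq: "proj e' (insert d S) x = const (ip x (e' d)) * e' d + proj e S x" for x
    using S d e'S by (auto simp: proj_def intro!: sum.cong)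
  have proj_orth: "proj e S (e' d) = 0" unfolding proj_def using o2 by (intro sum.neutral) auto
  have keep: "proj e' (insert d S) x = x" if "keys x \<subseteq> S" for x
  proof -
    have "ip x (e' d) = ip (proj e S x) (e' d)" using comp[OF that] by simp
    also have "\<dots> = 0" unfolding proj_def ip_sum_left
      using o2 by (intro sum.neutral) (auto simp: ip_const_left)
    finally show ?thesis using comp[OF that] by (simp add: projeq)
  qed
  have keep': "proj e' (insert d S) (e' d) = e' d" using o1 proj_orth by (simp add: projeq)
  have "proj e' (insert d S) x = x" if kx: "keys x \<subseteq> insert d S" for x
  proof -
    \<comment> \<open>\<open>e' d\<close> has coefficient \<open>c\<close> at \<open>d\<close>, so
      subtracting this multiple removes the exponent \<open>d\<close> from \<open>x\<close>.\<close>
    define t where "t = const (lookup x d / c)"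
    have "keys (x - t * e' d) \<subseteq> S"
    proof
      fix a assume a: "a \<in> keys (x - t * e' d)"
      have "keys (x - t * e' d) \<subseteq> insert d S"
        using kx kr unfolding t_def e'_def fun_upd_same
        by (intro keys_diff_subset keys_const_mult_subset)
      moreover have "lookup (x - t * e' d) d = 0"
        using c0 rd by (simp add: t_def e'_def lookup_minus)
      ultimately show "a \<in> S" using a by (auto simp: in_keys_iff)
    qed
    from keep[OF this] have "proj e' (insert d S) ((x - t * e' d) + t * e' d) = (x - t * e' d) + t * e' d"
      unfolding proj_add t_def proj_const keep' by simp
    then show ?thesis by simp
  qed
  moreover have "\<forall>a\<in>insert d S. keys (e' a) \<subseteq> insert d S"
    using ke kr by (auto simp: e'_def intro!: keys_const_mult_subset)
  ultimately show ?thesis using orth' e'S unfolding onb_def by blast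
qed

lemma onb_extend:
  assumes "finite D" "finite S" "S \<inter> D = {}" "onb e S"
  shows "\<exists>e'. onb e' (S \<union> D) \<and> (\<forall>a\<in>S. e' a = e a)"
  using assms
proof (induction D rule: finite_induct)
  case (insert d D)
  then obtain e1 where e1: "onb e1 (S \<union> D)" "\<forall>a\<in>S. e1 a = e a" by auto
  have "finite (S \<union> D)" "d \<notin> S \<union> D" using insert by auto
  from onb_insert[OF this e1(1)] obtain e2
    where "onb e2 (insert d (S \<union> D))" "\<forall>a\<in>S \<union> D. e2 a = e1 a" by blast
  then show ?case using e1 by (intro exI[of _ e2]) auto
qed auto

lemma onb_exists:
  assumes "finite S" obtains e where "onb e S"
proof -
  have "onb (\<lambda>_. 0) {}" by (simp add: onb_def orthonormal_def proj_def)
  from onb_extend[OF assms _ _ this] show ?thesis using that by auto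
qed

lemma parseval:
  assumes "finite S" "orthonormal e S" "proj e S x = x"
  shows "(\<Sum>a\<in>S. (cmod (ip x (e a)))\<^sup>2) = nm x"
  using nm_residual[OF assms(1,2), of x] assms(3) by (simp add: nm_def)

text \<open>Counting \<open>\<Sum>\<^sub>a \<parallel>e\<^sub>a - P e\<^sub>a\<parallel>\<^sup>2 = card S - \<Sum>\<^sub>i \<parallel>u\<^sub>i\<parallel>\<^sup>2 = 0\<close> for the projection \<open>P\<close> onto
  the \<open>u\<^sub>i\<close> replaces a dimension argument.\<close>

lemma orthonormal_complete:
  assumes S: "finite S" and I: "finite I" and card: "card I = card S"
    and u: "orthonormal u I" "\<And>i. i \<in> I \<Longrightarrow> keys (u i) \<subseteq> S" and x: "keys x \<subseteq> S"
  shows "proj u I x = x"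
proof -
  obtain e where e: "onb e S" using S onb_exists by blast
  have oe: "orthonormal e S" and ce: "\<And>x. keys x \<subseteq> S \<Longrightarrow> proj e S x = x"
    using e by (auto simp: onb_def)
  have n1: "nm (e a) = 1" if "a \<in> S" for a
    using oe that by (simp add: orthonormal_def nm_def)
  have n2: "nm (u i) = 1" if "i \<in> I" for i
    using u that by (simp add: orthonormal_def nm_def)
  have "(\<Sum>a\<in>S. nm (e a - proj u I (e a))) = (\<Sum>a\<in>S. 1 - (\<Sum>i\<in>I. (cmod (ip (e a) (u i)))\<^sup>2))"
    by (intro sum.cong) (auto simp: nm_residual[OF I u(1)] n1)
  also have "\<dots> = card S - (\<Sum>a\<in>S. \<Sum>i\<in>I. (cmod (ip (e a) (u i)))\<^sup>2)"
    by (simp add: sum_subtractf)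
  also have "(\<Sum>a\<in>S. \<Sum>i\<in>I. (cmod (ip (e a) (u i)))\<^sup>2) = (\<Sum>i\<in>I. \<Sum>a\<in>S. (cmod (ip (u i) (e a)))\<^sup>2)"
    by (subst sum.swap) (simp add: ip_cnj[of "u _"])
  also have "\<dots> = (\<Sum>i\<in>I. 1)"
    using parseval[OF S oe ce] u(2) n2 by (intro sum.cong) auto
  finally have "(\<Sum>a\<in>S. nm (e a - proj u I (e a))) = 0" using card by simp
  then have "nm (e a - proj u I (e a)) = 0" if "a \<in> S" for a
    using that S by (subst (asm) sum_nonneg_eq_0_iff) (auto simp: nm_nonneg)
  then have fix_e: "proj u I (e a) = e a" if "a \<in> S" for a
    using that by (simp add: nm_eq_0)
  have "proj u I (proj e S x) = proj e S x"
    unfolding proj_def[of e] by (simp add: proj_sum proj_const fix_e)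
  then show ?thesis by (simp add: ce x)
qed

lemma onb_orth:
  assumes "finite S" "finite T" "S \<subseteq> T" "onb e T" "onb e S" "a \<in> T - S" "keys x \<subseteq> S"
  shows "ip (e a) x = 0" "ip x (e a) = 0"
proof -
  have "x = proj e S x" using assms by (simp add: onb_def)
  moreover have "ip (e a) (e c) = 0" if "c \<in> S" for c
    using assms that unfolding onb_def orthonormal_def by (metis DiffE subsetD)
  ultimately show "ip (e a) x = 0"
    by (metis (no_types, lifting) ip_const_right ip_sum_right mult_zero_right proj_def sum.neutral)
  then show "ip x (e a) = 0" using ip_cnj[of x "e a"] by simp
qed

text \<open>Extending a basis of the smaller span and keeping only the added vectors gives a basis
  of the relative orthogonal complement, indexed by the new exponents.\<close>

lemma onb_relative:
  assumes "finite T" "S \<subseteq> T"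
  obtains e where "orthonormal e (T - S)" "\<And>a. a \<in> T - S \<Longrightarrow> keys (e a) \<subseteq> T"
    "\<And>a x. a \<in> T - S \<Longrightarrow> keys x \<subseteq> S \<Longrightarrow> ip (e a) x = 0"
proof -
  have fin: "finite S" using assms finite_subset by blast
  obtain e0 where e0: "onb e0 S" using onb_exists[OF fin] by blast
  obtain e where e: "onb e (S \<union> (T - S))" "\<forall>a\<in>S. e a = e0 a"
    using onb_extend[OF _ fin _ e0, of "T - S"] assms by auto
  have "S \<union> (T - S) = T" using assms by auto
  then have eT: "onb e T" using e by simp
  have "proj e S x = proj e0 S x" for x unfolding proj_def using e by (intro sum.cong) auto
  then have eS: "onb e S" using e0 e(2) by (simp add: onb_def orthonormal_def)
  show ?thesis
  proof
    show "orthonormal e (T - S)" using eT by (auto simp: onb_def orthonormal_def)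
    show "\<And>a. a \<in> T - S \<Longrightarrow> keys (e a) \<subseteq> T" using eT by (auto simp: onb_def)
    show "ip (e a) x = 0" if "a \<in> T - S" "keys x \<subseteq> S" for a x
      using onb_orth(1)[OF fin assms(1,2) eT eS that] .
  qed
qed

lemma nm_orthonormal_sum:
  assumes "finite I" "orthonormal u I"
  shows "nm (\<Sum>i\<in>I. const (c i) * u i) = (\<Sum>i\<in>I. (cmod (c i))\<^sup>2)"
proof -
  define y where "y = (\<Sum>i\<in>I. const (c i) * u i)"
  have coeff: "ip y (u j) = c j" if "j \<in> I" for j
  proof -
    have "ip y (u j) = (\<Sum>i\<in>I. if i = j then c j else 0)"
      unfolding y_def ip_sum_left using assms(2) that
      by (intro sum.cong) (auto simp: ip_const_left orthonormal_def)
    then show ?thesis using that assms(1) by simp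
  qed
  have "proj u I y = y" unfolding proj_def by (subst (2) y_def) (simp add: coeff)
  from parseval[OF assms this] show ?thesis by (simp add: coeff flip: y_def)
qed

end

section \<open>Orthogonality for Bernstein--Szego forms\<close>

text \<open>The traces of the weight 1/|p|^2 for a stable p. On the torus x times the conjugate of
  p, divided by |p|^2, is x/p with 1/p analytic, whence \<open>p_orth\<close>; in \<open>p_p\<close>
  the weight cancels |p|^2. The last axiom encodes that p(z1,0) has no zeros in the closed
  disk.\<close>

locale bernstein_szego = laurent_form +
  fixes p :: laurent and n1 n2 :: int
  assumes n1_nonneg: "0 \<le> n1" and n2_nonneg: "0 \<le> n2"
    and keys_p: "keys p \<subseteq> {0..n1} \<times> {0..n2}"
    and p_orth: "(\<And>a. a \<in> keys x \<Longrightarrow> snd a > 0 \<or> snd a = 0 \<and> fst a > 0) \<Longrightarrow> ip x p = 0"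
    and p_p: "ip (x * p) p = lookup x 0"
    and recurrence: "bounded (range \<tau>) \<Longrightarrow>
      (\<And>m. (\<Sum>l\<le>nat n1. cnj (lookup p (int l, 0)) * \<tau> (m + l)) = 0) \<Longrightarrow> \<tau> (m :: nat) = 0"
begin

text \<open>On the torus \<open>rv x\<close> has the same modulus as \<open>x\<close>, so reversal
  preserves the form up to swapping its arguments (\<open>ip_rv\<close>). It transports
  orthogonality at one corner of a box to the opposite corner.\<close>

definition rv :: "laurent \<Rightarrow> laurent" where
  "rv x = zpow n1 n2 * star x"

abbreviation pt :: laurent where
  "pt \<equiv> rv p"

lemma ip_mult_left: "ip (a * x) y = ip x (star a * y)"
  by (simp add: ip_def star_mult mult_ac)

lemma lookup_rv: "lookup (rv x) (i, j) = cnj (lookup x (n1 - i, n2 - j))"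
  by (simp add: rv_def)

lemma rv_rv [simp]: "rv (rv x) = x"
  by (rule poly_mapping_eqI) (auto simp: lookup_rv)

lemma keys_rv: "(i, j) \<in> keys (rv x) \<longleftrightarrow> (n1 - i, n2 - j) \<in> keys x"
  by (simp add: in_keys_iff lookup_rv)

lemma ip_rv: "ip (rv x) (rv y) = ip y x"
proof -
  have "rv x * star (rv y) = (zpow n1 n2 * star (zpow n1 n2)) * (y * star x)"
    by (simp add: rv_def star_mult mult_ac del: star_single)
  then show ?thesis by (simp add: ip_def zpow_star del: star_single)
qed

lemma pt_star_pt: "pt * star pt = p * star p"
proof -
  have "rv p * star (rv p) = (zpow n1 n2 * star (zpow n1 n2)) * (p * star p)"
    by (simp add: rv_def star_mult mult_ac del: star_single)
  then show ?thesis by (simp add: zpow_star del: star_single)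
qed

lemma keys_pt: "keys pt \<subseteq> {0..n1} \<times> {0..n2}"
  using keys_p by (auto simp: keys_rv)

lemma pt_orth:
  assumes "\<And>a. a \<in> keys x \<Longrightarrow> snd a < n2 \<or> snd a = n2 \<and> fst a < n1"
  shows "ip x pt = 0"
proof -
  have "ip (rv x) p = 0"
    using assms by (intro p_orth) (force simp: keys_rv)
  then show ?thesis using ip_rv[of "rv x" p] ip_cnj[of p "rv x"] by simp
qed

text \<open>The coefficient of \<open>\<bar>w\<^sub>2\<^sup>k\<close> in the one-variable Christoffel--Darboux kernel
  \<open>(p(z) \<bar>p(z\<^sub>1,w\<^sub>2) - p\<^sup>~(z) \<bar>p\<^sup>~(z\<^sub>1,w\<^sub>2)) / (1 - z\<^sub>2 \<bar>w\<^sub>2)\<close> on \<open>|z\<^sub>1| = 1\<close>. Its \<open>z\<^sub>1\<close>-degrees are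
  bounded, so that the dual basis of the monomials with \<open>z\<^sub>2\<close>-degree below \<open>n\<^sub>2\<close>
  consists of Laurent polynomials.\<close>

definition ker :: "int \<Rightarrow> laurent" where
  "ker k = zpow 0 k * (p * star (cut k p) - pt * star (cut k pt))"

text \<open>The full products \<open>p * star p\<close> and \<open>pt * star pt\<close> agree, so
  low truncations can be traded for high ones. One form of the kernel bounds its z2-degree from
  below, the other from above.\<close>

lemma ker_alt: "ker k = zpow 0 k * (pt * star (pt - cut k pt) - p * star (p - cut k p))"
proof -
  have "p * star (cut k p) - pt * star (cut k pt)
      = (p * star p - pt * star pt) + (pt * star (pt - cut k pt) - p * star (p - cut k p))"
    by (simp add: star_diff algebra_simps)
  then show ?thesis by (simp add: ker_def pt_star_pt)
qed

lemma keys_ker: "keys (ker k) \<subseteq> {-n1..n1} \<times> {0..n2 - 1}"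
proof -
  have le: "keys (x * star y) \<subseteq> {-n1..n1} \<times> {- l..}"
    if "keys x \<subseteq> {0..n1} \<times> {0..n2}" "keys y \<subseteq> {0..n1} \<times> {0..l}" for x y l
  proof
    fix a assume "a \<in> keys (x * star y)"
    then obtain b c where "b \<in> keys x" "c \<in> keys (star y)" "a = b + c" by (rule keys_mult_D)
    then show "a \<in> {-n1..n1} \<times> {- l..}"
      using that by (cases b; cases c) (force simp: keys_star)
  qed
  have ge: "keys (x * star y) \<subseteq> UNIV \<times> {.. n2 - l}"
    if "keys x \<subseteq> {0..n1} \<times> {0..n2}" "keys y \<subseteq> {0..n1} \<times> {l..}" for x y l
  proof
    fix a assume "a \<in> keys (x * star y)"
    then obtain b c where "b \<in> keys x" "c \<in> keys (star y)" "a = b + c" by (rule keys_mult_D)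
    then show "a \<in> UNIV \<times> {.. n2 - l}"
      using that by (cases b; cases c) (force simp: keys_star)
  qed
  have "keys (p * star (cut k p) - pt * star (cut k pt)) \<subseteq> {-n1..n1} \<times> {-k..}"
    using keys_p keys_pt by (intro keys_diff_subset[OF le le]) (auto simp: keys_cut)
  moreover have "keys (pt * star (pt - cut k pt) - p * star (p - cut k p)) \<subseteq> UNIV \<times> {.. n2 - (k + 1)}"
    using keys_p keys_pt by (intro keys_diff_subset[OF ge ge]) (auto simp: keys_minus_cut)
  moreover have "(a, b - k) \<in> keys (p * star (cut k p) - pt * star (cut k pt))"
    "(a, b - k) \<in> keys (pt * star (pt - cut k pt) - p * star (p - cut k p))"
    if "(a, b) \<in> keys (ker k)" for a b
    using that unfolding ker_def by (simp_all add: keys_zpow_mult ker_alt[unfolded ker_def])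
      (metis ker_alt ker_def keys_zpow_mult diff_zero that)
  ultimately show ?thesis by fastforce
qed

text \<open>This is the reproducing property. Truncating at \<open>k\<close> pushes the
  \<open>pt\<close> term into the half plane of \<open>pt_orth\<close>, and the discarded part of
  the \<open>p\<close> term into that of \<open>p_orth\<close>; only the contribution of
  \<open>p_p\<close> survives.\<close>

lemma ip_ker:
  assumes h: "keys h \<subseteq> UNIV \<times> {0..n2 - 1}"
  shows "ip h (zpow i 0 * ker k) = lookup h (i, k)"
proof -
  let ?m = "zpow (- i) (- k)"
  have swap: "ip h (zpow i k * (x * star y)) = ip (?m * y * h) x" for x y
    using ip_mult_left[of "?m * y" h x] by (simp add: star_mult mult_ac)
  have "zpow i 0 * ker k = zpow i k * (p * star (cut k p)) - zpow i k * (pt * star (cut k pt))"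
    by (simp add: ker_def zpow_mult right_diff_distrib flip: mult.assoc)
  then have "ip h (zpow i 0 * ker k) = ip (?m * cut k p * h) p - ip (?m * cut k pt * h) pt"
    by (simp add: ip_diff_right swap)
  also have "ip (?m * cut k pt * h) pt = 0"
  proof (rule pt_orth)
    fix a assume "a \<in> keys (?m * cut k pt * h)"
    then obtain b c where bc: "b \<in> keys (?m * cut k pt)" "c \<in> keys h" "a = b + c" by (rule keys_mult_D)
    then show "snd a < n2 \<or> snd a = n2 \<and> fst a < n1"
      using h by (cases b; cases c) (auto simp: keys_zpow_mult keys_cut)
  qed
  also have "?m * cut k p * h = (?m * h) * p - ?m * (p - cut k p) * h"
    by (simp add: algebra_simps)
  also have "ip \<dots> p = lookup (?m * h) 0 - ip (?m * (p - cut k p) * h) p"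
    by (simp add: ip_diff_left p_p)
  also have "ip (?m * (p - cut k p) * h) p = 0"
  proof (rule p_orth)
    fix a assume "a \<in> keys (?m * (p - cut k p) * h)"
    then obtain b c where bc: "b \<in> keys (?m * (p - cut k p))" "c \<in> keys h" "a = b + c"
      by (rule keys_mult_D)
    then show "snd a > 0 \<or> snd a = 0 \<and> fst a > 0"
      using h by (cases b; cases c) (auto simp: keys_zpow_mult keys_minus_cut)
  qed
  also have "lookup (?m * h) 0 = lookup h (i, k)" by (simp add: zero_prod_def)
  finally show ?thesis by simp
qed

section \<open>Moments and orthogonality on half strips\<close>

lemma zpow_expand:
  assumes "finite S" "keys x \<subseteq> S"
  shows "x = (\<Sum>a\<in>S. const (lookup x a) * zpow (fst a) (snd a))"
  using sum_monomials[OF assms] by (simp add: mult_single)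

text \<open>Duality: pairing \<open>g\<close> with the Laurent polynomial \<open>y\<close> whose
  coefficients are the moments \<open>u a\<close> gives exactly their square sum \<open>s\<close>,
  and Cauchy-Schwarz with the upper bound of the form yields s^2 <= nm g * Cu * s.\<close>

lemma ip_square_sum_le:
  assumes S: "finite S"
  shows "(\<Sum>a\<in>S. (cmod (ip g (zpow (fst a) (snd a))))\<^sup>2) \<le> Cu * nm g"
proof -
  define u where "u a = ip g (zpow (fst a) (snd a))" for a
  define y where "y = (\<Sum>a\<in>S. const (u a) * zpow (fst a) (snd a))"
  define s where "s = (\<Sum>a\<in>S. (cmod (u a))\<^sup>2)"
  have y': "y = (\<Sum>a\<in>S. single a (u a))" by (simp add: y_def mult_single)
  have ly: "lookup y a = (if a \<in> S then u a else 0)" for a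
    using S unfolding y' lookup_sum by (simp add: lookup_single when_def)
  have "keys y \<subseteq> S" using ly by (auto simp: in_keys_iff split: if_splits)
  then have ny: "nrm2 y = s" using S by (subst nrm2_eq[of S]) (auto simp: ly s_def)
  have "ip g y = (\<Sum>a\<in>S. cnj (u a) * u a)"
    by (simp add: y_def ip_sum_right ip_const_right u_def)
  also have "\<dots> = complex_of_real s"
    unfolding s_def of_real_sum complex_norm_square by (simp add: mult.commute)
  finally have "s\<^sup>2 \<le> nm g * nm y"
    using cauchy_schwarz[of g y] by simp
  also have "\<dots> \<le> nm g * (Cu * s)"
    using nm_upper[of y] nm_nonneg[of g] by (intro mult_left_mono) (auto simp: ny)
  finally have *: "s * s \<le> (Cu * nm g) * s" by (simp add: power2_eq_square mult_ac)
  have "s \<ge> 0" unfolding s_def by (intro sum_nonneg) auto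
  moreover have "Cu * nm g \<ge> 0"
  proof -
    have "0 \<le> Cu * nrm2 (1 :: laurent)" using nm_upper[of 1] nm_nonneg[of 1] by linarith
    moreover have "nrm2 (1 :: laurent) > 0"
      using nrm2_nonneg[of 1] nrm2_eq_0[of 1] by (simp add: less_le)
    ultimately show ?thesis using nm_nonneg[of g] by (simp add: zero_le_mult_iff)
  qed
  ultimately show ?thesis using * unfolding s_def u_def
    by (cases "s = 0") (auto simp: s_def u_def)
qed

lemma ip_zpow_tendsto_0: "(\<lambda>n. ip g (zpow (- int (n + c)) k)) \<longlonglongrightarrow> 0"
proof -
  define u where "u n = ip g (zpow (- int n) k)" for n
  have "(\<Sum>n<m. (cmod (u n))\<^sup>2) \<le> Cu * nm g" for m
  proof -
    have inj: "inj_on (\<lambda>n. (- int n, k)) {..<m}" by (auto intro: inj_onI)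
    have "(\<Sum>n<m. (cmod (u n))\<^sup>2)
        = (\<Sum>a\<in>(\<lambda>n. (- int n, k)) ` {..<m}. (cmod (ip g (zpow (fst a) (snd a))))\<^sup>2)"
      by (subst sum.reindex[OF inj]) (simp add: u_def)
    then show ?thesis using ip_square_sum_le[of "(\<lambda>n. (- int n, k)) ` {..<m}" g] by simp
  qed
  then have "summable (\<lambda>n. (cmod (u n))\<^sup>2)"
    by (intro summableI_nonneg_bounded[of _ "Cu * nm g"]) auto
  from summable_LIMSEQ_zero[OF this] have "u \<longlonglongrightarrow> 0"
    by (simp add: tendsto_norm_zero_iff)
  from LIMSEQ_ignore_initial_segment[OF this, of c] show ?thesis by (simp add: u_def)
qed

text \<open>The moments of \<open>g\<close> at negative powers of z1 are isolated in a truncated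
  element \<open>q N\<close>. Its coefficients inside the window are those of \<open>g\<close>,
  hence zero, so its norm is governed by the moments at the far end and tends to 0. Each fixed
  moment of \<open>g\<close> is a moment of all large \<open>q N\<close>, so it vanishes.\<close>

lemma orth_lower_half_plane:
  assumes g: "keys g \<subseteq> {0..n1} \<times> {0..n2 - 1}"
    and orth: "\<And>x. keys x \<subseteq> {0..n1 - 1} \<times> {0..n2 - 1} \<Longrightarrow> ip g x = 0"
    and x: "keys x \<subseteq> {..n1 - 1} \<times> {0..n2 - 1}"
  shows "ip g x = 0"
proof -
  define u where "u a = ip g (zpow (fst a) (snd a))" for a :: "int \<times> int"
  have u0: "u (i, k) = 0" if "0 \<le> i" "i < n1" "0 \<le> k" "k < n2" for i k
    unfolding u_def using that by (intro orth) auto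
  define B where "B N = {-N..-1} \<times> {0..n2 - 1}" for N :: int
  have finB: "finite (B N)" for N by (simp add: B_def)
  \<comment> \<open>A combination of dual basis vectors: within the strip \<open>q N\<close> has the
    same moments as \<open>g\<close> on \<open>B N\<close> and zero moments elsewhere.\<close>
  define q where "q N = (\<Sum>a\<in>B N. const (u a) * (zpow (fst a) 0 * ker (snd a)))" for N
  have kq: "keys (q N) \<subseteq> UNIV \<times> {0..n2 - 1}" for N
    unfolding q_def using keys_ker
    by (intro keys_sum_subset keys_const_mult_subset) (fastforce simp: keys_zpow_mult)
  have ipq: "ip y (q N) = (\<Sum>a\<in>B N. cnj (u a) * lookup y a)"
    if "keys y \<subseteq> UNIV \<times> {0..n2 - 1}" for y N
    unfolding q_def ip_sum_right by (simp add: ip_const_right ip_ker[OF that])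
  \<comment> \<open>The dual vector at (i, k) has z1-width \<open>n1\<close> on each side. For these
    \<open>i\<close> its support meets only \<open>B N\<close> and exponents 0..n1-1, where the
    moments of \<open>g\<close> vanish by hypothesis; so \<open>q N\<close> and \<open>g\<close>
    have the same coefficient at (i, k), and that of \<open>g\<close> is 0 since i < 0.\<close>
  have q_interior: "lookup (q N) (i, k) = 0" if i: "- N + n1 \<le> i" "i < 0" for N i k
  proof -
    define y where "y = zpow i 0 * ker k"
    define T where "T = {i - n1..i + n1} \<times> {0..n2 - 1}"
    have finT: "finite T" by (simp add: T_def)
    have ky: "keys y \<subseteq> T"
      using keys_ker[of k] by (force simp: y_def T_def keys_zpow_mult)
    have ky': "keys y \<subseteq> UNIV \<times> {0..n2 - 1}" using ky by (auto simp: T_def)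
    have "ip g y = (\<Sum>a\<in>T. cnj (lookup y a) * u a)"
      by (subst zpow_expand[OF finT ky]) (simp add: ip_sum_right ip_const_right u_def)
    also have "\<dots> = (\<Sum>a\<in>T \<inter> B N. cnj (lookup y a) * u a)"
    proof (intro sum.mono_neutral_right finT ballI)
      fix a assume a: "a \<in> T - T \<inter> B N"
      then have "0 \<le> fst a" "fst a < n1" "0 \<le> snd a" "snd a < n2"
        using i by (auto simp: T_def B_def)
      then show "cnj (lookup y a) * u a = 0" using u0[of "fst a" "snd a"] by simp
    qed auto
    also have "\<dots> = (\<Sum>a\<in>B N. cnj (lookup y a) * u a)"
      using ky by (intro sum.mono_neutral_left finB) (auto simp: in_keys_iff)
    also have "\<dots> = cnj (ip y (q N))"
      by (simp add: ipq[OF ky'] mult.commute)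
    also have "\<dots> = lookup (q N) (i, k)"
      unfolding y_def by (subst ip_cnj) (simp add: ip_ker[OF kq])
    finally have "lookup (q N) (i, k) = ip g y" ..
    also have "\<dots> = lookup g (i, k)"
      unfolding y_def using g by (intro ip_ker) auto
    also have "\<dots> = 0"
      using g i by (auto simp: in_keys_iff[of _ g])
    finally show ?thesis .
  qed
  define strip where "strip N = {-N..-N + n1 - 1} \<times> {0..n2 - 1}" for N :: int
  define A where "A N = (\<Sum>a\<in>strip N. cmod (u a))" for N
  \<comment> \<open>Only the \<open>n1\<close> leftmost columns contribute to the pairing of
    \<open>q N\<close> with itself. Bounding the coefficients there by the norm gives an inequality
    between \<open>nm (q N)\<close> and its own square root, which is then solved.\<close>
  have nmq: "nm (q N) \<le> (A N)\<^sup>2 / dl" if "N \<ge> n1" for N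
  proof -
    have "ip (q N) (q N) = (\<Sum>a\<in>strip N. cnj (u a) * lookup (q N) a)"
      unfolding ipq[OF kq]
    proof (rule sum.mono_neutral_right[OF finB])
      show "strip N \<subseteq> B N" using that by (auto simp: strip_def B_def)
      show "\<forall>a\<in>B N - strip N. cnj (u a) * lookup (q N) a = 0"
      proof
        fix a assume "a \<in> B N - strip N"
        then have "lookup (q N) (fst a, snd a) = 0"
          by (intro q_interior[of N]) (auto simp: strip_def B_def)
        then show "cnj (u a) * lookup (q N) a = 0" by simp
      qed
    qed
    then have "complex_of_real (nm (q N)) = (\<Sum>a\<in>strip N. cnj (u a) * lookup (q N) a)"
      by (simp add: ip_self)
    then have "nm (q N) = cmod (\<Sum>a\<in>strip N. cnj (u a) * lookup (q N) a)"
      using nm_nonneg[of "q N"] by (metis abs_of_nonneg norm_of_real)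
    also have "\<dots> \<le> (\<Sum>a\<in>strip N. cmod (u a) * sqrt (nrm2 (q N)))"
      by (rule sum_norm_le)
         (auto simp: norm_mult intro!: mult_left_mono real_le_rsqrt lookup_le_nrm2)
    also have "\<dots> = A N * sqrt (nrm2 (q N))" by (simp add: A_def sum_distrib_right)
    finally have "(nm (q N))\<^sup>2 \<le> (A N * sqrt (nrm2 (q N)))\<^sup>2"
      using nm_nonneg by (intro power_mono) auto
    also have "\<dots> = (A N)\<^sup>2 * nrm2 (q N)" using nrm2_nonneg by (simp add: power_mult_distrib)
    also have "\<dots> \<le> (A N)\<^sup>2 * (nm (q N) / dl)"
      using nm_lower[of "q N"] dl_pos by (intro mult_left_mono) (auto simp: field_simps)
    finally have "nm (q N) * nm (q N) \<le> (A N)\<^sup>2 / dl * nm (q N)"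
      by (simp add: power2_eq_square)
    moreover have "(A N)\<^sup>2 / dl \<ge> 0" using dl_pos by simp
    ultimately show ?thesis using nm_nonneg[of "q N"]
      by (cases "nm (q N) = 0") (simp, metis less_le mult_le_cancel_right_pos)
  qed
  \<comment> \<open>With N = m + n1 the exponents in the end strip are -(m + c) for finitely many
    constants c between 1 and \<open>n1\<close>, so each summand is a tail of a sequence of
    moments.\<close>
  have A_lim: "(\<lambda>m. A (int m + n1)) \<longlonglongrightarrow> 0"
  proof -
    have "A (int m + n1) = (\<Sum>t\<in>{0..n1 - 1} \<times> {0..n2 - 1}. cmod (ip g (zpow (- int (m + nat (n1 - fst t))) (snd t))))" for m
      unfolding A_def strip_def
      by (rule sum.reindex_bij_witness[of _ "\<lambda>(a, k). (a - int m - n1, k)" "\<lambda>(a, k). (a + int m + n1, k)"])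
         (auto simp: u_def algebra_simps)
    moreover have "(\<lambda>m. \<Sum>t\<in>{0..n1 - 1} \<times> {0..n2 - 1}.
        cmod (ip g (zpow (- int (m + nat (n1 - fst t))) (snd t)))) \<longlonglongrightarrow> 0"
      by (intro tendsto_null_sum tendsto_norm_zero ip_zpow_tendsto_0)
    ultimately show ?thesis by simp
  qed
  have u_neg: "u (i, k) = 0" if ik: "i < 0" "0 \<le> k" "k < n2" for i k
  proof -
    have bound: "(cmod (u (i, k)))\<^sup>2 \<le> nm (zpow i k) * ((A (int m + n1))\<^sup>2 / dl)"
      if m: "m \<ge> nat (- i)" for m
    proof -
      let ?N = "int m + n1"
      have mem: "(i, k) \<in> B ?N" using ik m n1_nonneg by (auto simp: B_def)
      have "ip (zpow i k) (q ?N) = (\<Sum>a\<in>B ?N. cnj (u a) * lookup (zpow i k) a)"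
        using ik by (intro ipq) auto
      also have "\<dots> = (\<Sum>a\<in>B ?N. if a = (i, k) then cnj (u a) else 0)"
        by (intro sum.cong) (auto simp: lookup_single when_def)
      also have "\<dots> = cnj (u (i, k))" using mem finB by simp
      finally have "(cmod (u (i, k)))\<^sup>2 \<le> nm (zpow i k) * nm (q ?N)"
        using cauchy_schwarz[of "zpow i k" "q ?N"] by simp
      also have "\<dots> \<le> nm (zpow i k) * ((A ?N)\<^sup>2 / dl)"
        by (intro mult_left_mono nmq nm_nonneg) auto
      finally show ?thesis .
    qed
    have "(\<lambda>m. nm (zpow i k) * ((A (int m + n1))\<^sup>2 / dl)) \<longlonglongrightarrow> nm (zpow i k) * (0\<^sup>2 / dl)"
      using dl_pos by (intro tendsto_intros A_lim) auto
    from LIMSEQ_le_const[OF this] have "(cmod (u (i, k)))\<^sup>2 \<le> nm (zpow i k) * (0\<^sup>2 / dl)"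
      using bound by blast
    then show ?thesis by simp
  qed
  have "ip g x = (\<Sum>a\<in>keys x. cnj (lookup x a) * u a)"
    by (subst zpow_expand[of "keys x" x]) (auto simp: ip_sum_right ip_const_right u_def)
  also have "\<dots> = 0"
  proof (intro sum.neutral ballI)
    fix a assume "a \<in> keys x"
    then have "u a = 0" using x u0[of "fst a" "snd a"] u_neg[of "fst a" "snd a"]
      by (cases "fst a < 0") auto
    then show "cnj (lookup x a) * u a = 0" by simp
  qed
  finally show ?thesis .
qed

text \<open>Multiplying \<open>f\<close> by the conjugate of p(z1,0) makes its z2^n2 part a multiple
  of that of \<open>pt\<close>. Subtracting this multiple of \<open>pt\<close> leaves an element of
  the half strip. Both pieces are orthogonal to \<open>g\<close>, also after a shift by z1^(-m), and
  this is a recurrence for the numbers \<open>t m\<close>. Shifts are isometries, so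
  \<open>t\<close> is bounded and therefore zero.\<close>

lemma orth_complements:
  assumes g: "keys g \<subseteq> {0..n1} \<times> {0..n2 - 1}"
    and orth: "\<And>x. keys x \<subseteq> {0..n1 - 1} \<times> {0..n2 - 1} \<Longrightarrow> ip g x = 0"
    and f: "keys f \<subseteq> {0..n1 - 1} \<times> {0..n2}"
  shows "ip f g = 0"
proof -
  define t where "t m = ip (zpow (- int m) 0 * f) g" for m
  define p0 where "p0 = cut 0 p"
  define fl where "fl = cut (n2 - 1) f"
  define phi where "phi = zpow 0 (- n2) * (f - fl)"
  define pl where "pl = cut (n2 - 1) pt"
  define r where "r = star p0 * fl - zpow (- n1) 0 * phi * pl"
  have kphi: "keys phi \<subseteq> {0..n1 - 1} \<times> {0}"
    unfolding phi_def fl_def using f by (auto simp: keys_zpow_mult keys_minus_cut)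
  \<comment> \<open>Reversal exchanges the z2^0 part of p with the z2^n2 part of \<open>pt\<close>;
    this is why p(z1,0) governs the recurrence.\<close>
  have pt_top: "pt - pl = zpow n1 n2 * star p0"
    by (rule poly_mapping_eqI) (auto simp: pl_def p0_def lookup_minus lookup_rv)
  have "star p0 * (f - fl) = zpow (- n1) 0 * phi * (pt - pl)"
  proof -
    have "zpow (- n1) 0 * phi * (pt - pl) = (zpow (- n1) 0 * zpow 0 (- n2) * zpow n1 n2) * (star p0 * (f - fl))"
      unfolding pt_top phi_def by (simp only: mult_ac)
    also have "zpow (- n1) 0 * zpow 0 (- n2) * zpow n1 n2 = 1" by (simp add: zpow_mult zpow_0)
    finally show ?thesis by simp
  qed
  then have decomp: "star p0 * f = r + zpow (- n1) 0 * phi * pt"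
    by (simp add: r_def algebra_simps)
  have kr: "keys r \<subseteq> {..n1 - 1} \<times> {0..n2 - 1}"
    unfolding r_def
  proof (intro keys_diff_subset subsetI)
    fix a assume "a \<in> keys (star p0 * fl)"
    then obtain b c where bc: "b \<in> keys (star p0)" "c \<in> keys fl" "a = b + c" by (rule keys_mult_D)
    then show "a \<in> {..n1 - 1} \<times> {0..n2 - 1}" using keys_p f
      by (cases b; cases c) (force simp: keys_star p0_def fl_def keys_cut)
  next
    fix a assume "a \<in> keys (zpow (- n1) 0 * phi * pl)"
    then obtain b c where bc: "b \<in> keys (zpow (- n1) 0 * phi)" "c \<in> keys pl" "a = b + c"
      by (rule keys_mult_D)
    then show "a \<in> {..n1 - 1} \<times> {0..n2 - 1}" using keys_pt kphi
      by (cases b; cases c) (force simp: keys_zpow_mult pl_def keys_cut)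
  qed
  have zero: "ip (zpow (- int m) 0 * (star p0 * f)) g = 0" for m
  proof -
    define Y where "Y = zpow (- int m) 0 * (zpow (- n1) 0 * phi)"
    have "ip g (zpow (- int m) 0 * r) = 0"
      using kr by (intro orth_lower_half_plane[OF g orth]) (force simp: keys_zpow_mult)+
    then have "ip (zpow (- int m) 0 * r) g = 0" using ip_cnj[of "zpow (- int m) 0 * r" g] by simp
    moreover have "ip (star Y * g) pt = 0"
    proof (rule pt_orth)
      fix a assume "a \<in> keys (star Y * g)"
      then obtain b c where "b \<in> keys (star Y)" "c \<in> keys g" "a = b + c" by (rule keys_mult_D)
      then show "snd a < n2 \<or> snd a = n2 \<and> fst a < n1" using kphi g
        by (cases b; cases c) (force simp: keys_star Y_def keys_zpow_mult)
    qed
    then have "ip (Y * pt) g = 0" using ip_mult_left[of "star Y" g pt] ip_cnj[of "Y * pt" g] by simp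
    ultimately show ?thesis by (simp add: decomp Y_def ring_distribs ip_add_left mult.assoc)
  qed
  have p0_expand: "star p0 = (\<Sum>l\<le>nat n1. const (cnj (lookup p (int l, 0))) * zpow (- int l) 0)"
  proof -
    have inj: "inj_on (\<lambda>l. (int l, 0 :: int)) {..nat n1}" by (auto intro: inj_onI)
    have "keys p0 \<subseteq> (\<lambda>l. (int l, 0)) ` {..nat n1}"
    proof
      fix a assume "a \<in> keys p0"
      then have "a = (int (nat (fst a)), 0)" "nat (fst a) \<le> nat n1"
        using keys_p by (cases a; force simp: p0_def keys_cut)+
      then show "a \<in> (\<lambda>l. (int l, 0)) ` {..nat n1}" by blast
    qed
    from sum_monomials[OF _ this] have "p0 = (\<Sum>l\<le>nat n1. single (int l, 0) (lookup p0 (int l, 0)))"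
      by (simp add: sum.reindex[OF inj])
    then have "star p0 = (\<Sum>l\<le>nat n1. star (single (int l, 0) (lookup p0 (int l, 0))))"
      by (metis star_sum)
    then show ?thesis by (simp add: p0_def mult_single)
  qed
  have rec: "(\<Sum>l\<le>nat n1. cnj (lookup p (int l, 0)) * t (m + l)) = 0" for m
  proof -
    have "zpow (- int m) 0 * (star p0 * f)
        = (\<Sum>l\<le>nat n1. const (cnj (lookup p (int l, 0))) * ((zpow (- int m) 0 * zpow (- int l) 0) * f))"
      unfolding p0_expand sum_distrib_left sum_distrib_right by (simp only: mult_ac)
    also have "\<dots> = (\<Sum>l\<le>nat n1. const (cnj (lookup p (int l, 0))) * (zpow (- int (m + l)) 0 * f))"
      by (simp add: zpow_mult)
    finally have "ip (zpow (- int m) 0 * (star p0 * f)) g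
        = (\<Sum>l\<le>nat n1. cnj (lookup p (int l, 0)) * t (m + l))"
      by (simp only: ip_sum_left ip_const_left t_def)
    then show ?thesis using zero[of m] by simp
  qed
  have "bounded (range t)"
  proof (rule boundedI)
    fix y assume "y \<in> range t"
    then obtain m where y: "y = t m" by auto
    have "nm (zpow (- int m) 0 * f) = nm f" by (simp add: nm_def ip_zpow)
    then have "(cmod (t m))\<^sup>2 \<le> nm f * nm g"
      using cauchy_schwarz[of "zpow (- int m) 0 * f" g] by (simp add: t_def)
    then show "norm y \<le> sqrt (nm f * nm g)" unfolding y by (rule real_le_rsqrt)
  qed
  from recurrence[OF this rec, of 0] show ?thesis by (simp add: t_def zpow_0)
qed

section \<open>Two orthonormal families and the contraction between them\<close>

lemma keys_zpow_box:
  assumes "keys x \<subseteq> {a..b} \<times> {c..d}"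
  shows "keys (zpow i j * x) \<subseteq> {a + i..b + i} \<times> {c + j..d + j}"
proof
  fix k assume "k \<in> keys (zpow i j * x)"
  then have "(fst k - i, snd k - j) \<in> keys x" by (cases k) (simp add: keys_zpow_mult)
  then have "(fst k - i, snd k - j) \<in> {a..b} \<times> {c..d}" using assms by blast
  then show "k \<in> {a + i..b + i} \<times> {c + j..d + j}" by (cases k) auto
qed

lemma keys_rv_box:
  assumes "keys x \<subseteq> {a..b} \<times> {c..d}"
  shows "keys (rv x) \<subseteq> {n1 - b..n1 - a} \<times> {n2 - d..n2 - c}"
proof
  fix k assume "k \<in> keys (rv x)"
  then have "(n1 - fst k, n2 - snd k) \<in> keys x" by (cases k) (simp add: keys_rv)
  then have "(n1 - fst k, n2 - snd k) \<in> {a..b} \<times> {c..d}" using assms by blast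
  then show "k \<in> {n1 - b..n1 - a} \<times> {n2 - d..n2 - c}" by (cases k) auto
qed

text \<open>\<open>X\<close> lists bases of F and G. The vectors \<open>X i\<close> and
  \<open>pt\<close> are expanded in the orthonormal basis formed by \<open>p\<close> and the
  products \<open>Z j * X j\<close>. The entries of \<open>K\<close> are inner products between two
  orthonormal families, so contractivity is Bessel's inequality.\<close>

lemma realization:
  fixes Z :: "nat \<Rightarrow> laurent" and N :: nat
  defines "Z \<equiv> (\<lambda>j. if j < nat n1 then zpow 1 0 else zpow 0 1)"
    and "N \<equiv> nat n1 + nat n2"
  obtains X :: "nat \<Rightarrow> laurent" and K l b a where
    "\<And>i. i < N \<Longrightarrow> X i = const (l i) * p + (\<Sum>j<N. const (K i j) * (Z j * X j))"
    "pt = const a * p + (\<Sum>j<N. const (b j) * (Z j * X j))"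
    "\<And>v. (\<Sum>i<N. (cmod (\<Sum>j<N. K i j * v j))\<^sup>2) \<le> (\<Sum>j<N. (cmod (v j))\<^sup>2)"
proof -
  define B12 where "B12 = {0..n1 - 1} \<times> {0..n2 - 1}"
  define B1 where "B1 = {0..n1 - 1} \<times> {0..n2}"
  define B2 where "B2 = {0..n1} \<times> {0..n2 - 1}"
  define zB where "zB = {1..n1} \<times> {0..n2 - 1}"
  define B where "B = {0..n1} \<times> {0..n2}"
  note defs = B12_def B1_def B2_def zB_def B_def
  have fin: "finite B12" "finite B1" "finite B2" "finite zB" "finite B" by (auto simp: defs)
  have sub: "B12 \<subseteq> B1" "zB \<subseteq> B2" "B1 \<subseteq> B" "B2 \<subseteq> B" by (auto simp: defs)
  obtain f where f: "orthonormal f (B1 - B12)" "\<And>a. a \<in> B1 - B12 \<Longrightarrow> keys (f a) \<subseteq> B1"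
    "\<And>a x. a \<in> B1 - B12 \<Longrightarrow> keys x \<subseteq> B12 \<Longrightarrow> ip (f a) x = 0"
    using onb_relative[OF fin(2) sub(1)] by blast
  obtain g where g: "orthonormal g (B2 - zB)" "\<And>a. a \<in> B2 - zB \<Longrightarrow> keys (g a) \<subseteq> B2"
    "\<And>a x. a \<in> B2 - zB \<Longrightarrow> keys x \<subseteq> zB \<Longrightarrow> ip (g a) x = 0"
    using onb_relative[OF fin(3) sub(2)] by blast
  obtain e12 where e12: "onb e12 B12" using onb_exists fin by blast
  obtain eM where eM: "onb eM zB" using onb_exists fin by blast
  \<comment> \<open>Removing from \<open>y\<close> its projection to P(n1-1,n2-1) leaves an element
    covered by \<open>orth_complements\<close>; the projection itself is orthogonal to
    \<open>f a\<close> by construction.\<close>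
  have f_B2: "ip (f a) y = 0" if a: "a \<in> B1 - B12" and y: "keys y \<subseteq> B2" for a y
  proof -
    define r where "r = y - proj e12 B12 y"
    have k: "keys (proj e12 B12 y) \<subseteq> B12" using e12 by (intro keys_proj) (auto simp: onb_def)
    have 1: "ip r x = 0" if "keys x \<subseteq> B12" for x
    proof -
      have "ip r (e12 b) = 0" if "b \<in> B12" for b
        using ip_proj[OF fin(1) _ that, of e12 y] e12 by (simp add: r_def ip_diff_left onb_def)
      then have "ip r (proj e12 B12 x) = 0"
        unfolding proj_def[of _ _ x] ip_sum_right by (simp add: ip_const_right)
      then show ?thesis using e12 that by (simp add: onb_def)
    qed
    have 2: "keys r \<subseteq> B2" using k y unfolding r_def by (intro keys_diff_subset) (auto simp: defs)
    have "ip (f a) r = 0"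
      by (rule orth_complements[OF 2[unfolded B2_def] 1[unfolded B12_def] f(2)[OF a, unfolded B1_def]])
    then show ?thesis using f(3)[OF a k] by (simp add: r_def ip_diff_right)
  qed
  \<comment> \<open>Reversal carries z2 G and z1 P(n1-1,n2) to the positions of \<open>g\<close> and
    \<open>f\<close> in \<open>orth_complements\<close>: z2 times \<open>zB\<close> becomes
    P(n1-1,n2-1).\<close>
  have zg_B1: "ip x (zpow 0 1 * g a) = 0" if a: "a \<in> B2 - zB" and x: "keys x \<subseteq> {1..n1} \<times> {0..n2}" for a x
  proof -
    let ?h = "rv (zpow 0 1 * g a)"
    have kg: "keys (g a) \<subseteq> B2" using g(2)[OF a] .
    have 1: "ip ?h y = 0" if y: "keys y \<subseteq> {0..n1 - 1} \<times> {0..n2 - 1}" for y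
    proof -
      have "ip ?h y = ip ?h (rv (rv y))" by simp
      also have "\<dots> = ip (rv y) (zpow 0 1 * g a)" by (rule ip_rv)
      also have "\<dots> = ip (zpow 0 1 * (zpow 0 (-1) * rv y)) (zpow 0 1 * g a)"
        by (simp add: zpow_mult zpow_0 flip: mult.assoc)
      also have "\<dots> = ip (zpow 0 (-1) * rv y) (g a)" by (rule ip_zpow)
      also have "\<dots> = cnj (ip (g a) (zpow 0 (-1) * rv y))" by (rule ip_cnj)
      also have "ip (g a) (zpow 0 (-1) * rv y) = 0"
      proof (rule g(3)[OF a])
        show "keys (zpow 0 (-1) * rv y) \<subseteq> zB"
          using keys_zpow_box[OF keys_rv_box[OF y], of 0 "-1"] by (simp add: defs)
      qed
      finally show ?thesis by simp
    qed
    have 2: "keys ?h \<subseteq> {0..n1} \<times> {0..n2 - 1}"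
      using keys_rv_box[OF keys_zpow_box[OF kg[unfolded defs]], of 0 1] by simp
    have "keys (rv x) \<subseteq> {0..n1 - 1} \<times> {0..n2}"
      using keys_rv_box[OF x] by simp
    then have "ip (rv x) ?h = 0" using orth_complements[of ?h "rv x"] 1 2 by blast
    then show ?thesis using ip_rv[of x "zpow 0 1 * g a"] ip_cnj[of x "zpow 0 1 * g a"] by simp
  qed
  \<comment> \<open>\<open>B1 - B12\<close> is the top row and \<open>B2 - zB\<close> the left
    column; they are enumerated in the order of the two blocks of Z.\<close>
  define ix where "ix i = (if i < nat n1 then (int i, n2) else (0, int (i - nat n1)))" for i
  define X where "X i = (if i < nat n1 then f (ix i) else g (ix i))" for i
  define Y where "Y i = Z i * X i" for i
  have ixf: "ix i \<in> B1 - B12" if "i < nat n1" for i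
    using that n2_nonneg by (auto simp: ix_def defs)
  have ixg: "ix i \<in> B2 - zB" if "i < N" "\<not> i < nat n1" for i
    using that n1_nonneg by (auto simp: ix_def defs N_def)
  have ix_inj: "ix i = ix j \<longleftrightarrow> i = j" if "i < nat n1 \<longleftrightarrow> j < nat n1" for i j
    using that by (auto simp: ix_def)
  have fg: "ip (f (ix i)) (g (ix j)) = 0" "ip (g (ix j)) (f (ix i)) = 0"
    if "i < nat n1" "j < N" "\<not> j < nat n1" for i j
    using f_B2[OF ixf g(2)[OF ixg], of i j] that ip_cnj[of "g (ix j)" "f (ix i)"] by auto
  have zf_keys: "keys (zpow 1 0 * f (ix i)) \<subseteq> {1..n1} \<times> {0..n2}" if "i < nat n1" for i
    using keys_zpow_box[OF f(2)[OF ixf[OF that], unfolded defs], of 1 0] by simp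
  have zg_keys: "keys (zpow 0 1 * g (ix i)) \<subseteq> {0..n1} \<times> {1..n2}" if "i < N" "\<not> i < nat n1" for i
    using keys_zpow_box[OF g(2)[OF ixg[OF that], unfolded defs], of 0 1] by simp
  have zfg: "ip (zpow 1 0 * f (ix i)) (zpow 0 1 * g (ix j)) = 0"
    "ip (zpow 0 1 * g (ix j)) (zpow 1 0 * f (ix i)) = 0"
    if "i < nat n1" "j < N" "\<not> j < nat n1" for i j
    using zg_B1[OF ixg zf_keys, of j i] that
      ip_cnj[of "zpow 0 1 * g (ix j)" "zpow 1 0 * f (ix i)"] by auto
  have X_orth: "orthonormal X {..<N}"
    unfolding orthonormal_def
  proof (intro ballI)
    fix i j assume "i \<in> {..<N}" "j \<in> {..<N}"
    then have ij: "i < N" "j < N" by auto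
    consider "i < nat n1" "j < nat n1" | "\<not> i < nat n1" "\<not> j < nat n1"
      | "i < nat n1" "\<not> j < nat n1" | "\<not> i < nat n1" "j < nat n1" by blast
    then show "ip (X i) (X j) = (if i = j then 1 else 0)"
    proof cases
      case 1
      then show ?thesis
        using f(1) ixf[of i] ixf[of j] ix_inj[of i j] by (simp add: X_def orthonormal_def)
    next
      case 2
      then show ?thesis
        using g(1) ixg[of i] ixg[of j] ix_inj[of i j] ij by (simp add: X_def orthonormal_def)
    next
      case 3
      then show ?thesis using fg(1)[OF 3(1) ij(2) 3(2)] by (auto simp: X_def)
    next
      case 4
      then show ?thesis using fg(2)[OF 4(2) ij(1) 4(1)] by (auto simp: X_def)
    qed
  qed
  have Y_eq: "Y i = (if i < nat n1 then zpow 1 0 * f (ix i) else zpow 0 1 * g (ix i))" for i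
    by (simp add: Y_def X_def Z_def)
  have Y_orth: "orthonormal Y {..<N}"
    unfolding orthonormal_def
  proof (intro ballI)
    fix i j assume ij: "i \<in> {..<N}" "j \<in> {..<N}"
    show "ip (Y i) (Y j) = (if i = j then 1 else 0)"
    proof (cases "i < nat n1 \<longleftrightarrow> j < nat n1")
      case True
      then have "ip (Y i) (Y j) = ip (X i) (X j)" by (simp add: Y_def Z_def ip_zpow)
      then show ?thesis using X_orth ij by (simp add: orthonormal_def)
    next
      case False
      then show ?thesis using zfg[of i j] zfg[of j i] ij by (auto simp: Y_eq)
    qed
  qed
  have kX: "keys (X i) \<subseteq> B" if "i < N" for i
    using order_trans[OF f(2)[OF ixf] sub(3)] order_trans[OF g(2)[OF ixg] sub(4)] that
    by (simp add: X_def)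
  have kY: "keys (Y i) \<subseteq> {1..n1} \<times> {0..n2} \<union> {0..n1} \<times> {1..n2}" if "i < N" for i
    using zf_keys[of i] zg_keys[of i] that by (auto simp: Y_eq)
  have p_Y: "ip (Y i) p = 0" "ip p (Y i) = 0" if "i < N" for i
  proof -
    show "ip (Y i) p = 0" using kY[OF that] by (intro p_orth) force
    then show "ip p (Y i) = 0" using ip_cnj[of p "Y i"] by simp
  qed
  have pp1: "ip p p = 1" using p_p[of 1] by simp
  define u where "u i = (if i < N then Y i else p)" for i
  have u_orth: "orthonormal u {..N}"
    using Y_orth p_Y pp1 unfolding orthonormal_def u_def by auto
  have X_zB: "ip (X i) x = 0" if "i < N" "keys x \<subseteq> zB" for i x
  proof (cases "i < nat n1")
    case True
    then show ?thesis using f_B2[OF ixf[OF True] order_trans[OF that(2) sub(2)]] by (simp add: X_def)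
  next
    case False
    then show ?thesis using g(3)[OF ixg[OF that(1) False] that(2)] by (simp add: X_def)
  qed
  have Y_zB: "ip x (Y i) = 0" if i: "i < N" and x: "keys x \<subseteq> zB" for i x
  proof (cases "i < nat n1")
    case True
    have "ip x (Y i) = ip (zpow 1 0 * (zpow (-1) 0 * x)) (zpow 1 0 * f (ix i))"
      using True by (simp add: Y_eq zpow_mult zpow_0 flip: mult.assoc)
    also have "\<dots> = ip (zpow (-1) 0 * x) (f (ix i))" by (rule ip_zpow)
    also have "\<dots> = cnj (ip (f (ix i)) (zpow (-1) 0 * x))" by (rule ip_cnj)
    also have "ip (f (ix i)) (zpow (-1) 0 * x) = 0"
      using x by (intro f(3) ixf True) (force simp: keys_zpow_mult defs)
    finally show ?thesis by simp
  next
    case False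
    have "keys x \<subseteq> {1..n1} \<times> {0..n2}" using x by (force simp: defs)
    from zg_B1[OF ixg[OF i False] this] show ?thesis using False by (simp add: Y_eq)
  qed
  have pt_zB: "ip x pt = 0" if "keys x \<subseteq> zB" for x
    using that by (intro pt_orth) (force simp: defs)
  have p_zB: "ip x p = 0" if "keys x \<subseteq> zB" for x
    using that by (intro p_orth) (force simp: defs)
  \<comment> \<open>A basis of the span of \<open>zB\<close> together with the \<open>Y j\<close>
    and \<open>p\<close> has n1 n2 + (n1 + n2) + 1 = (n1 + 1)(n2 + 1) members, the dimension of
    P(n1,n2), so \<open>orthonormal_complete\<close> applies; the part along \<open>zB\<close> drops
    out.\<close>
  have expand: "x = const (ip x p) * p + (\<Sum>j<N. const (ip x (Y j)) * Y j)"
    if kx: "keys x \<subseteq> B" and x0: "\<And>y. keys y \<subseteq> zB \<Longrightarrow> ip x y = 0" for x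
  proof -
    define w where "w = case_sum eM u"
    let ?I = "Inl ` zB \<union> Inr ` {..N}"
    have kM: "keys (eM a) \<subseteq> zB" if "a \<in> zB" for a using eM that by (auto simp: onb_def)
    have M_u: "ip (eM a) (u i) = 0" "ip (u i) (eM a) = 0" if "a \<in> zB" "i \<le> N" for a i
    proof -
      show "ip (eM a) (u i) = 0"
        using Y_zB[OF _ kM[OF that(1)], of i] p_zB[OF kM[OF that(1)]] that by (simp add: u_def)
      then show "ip (u i) (eM a) = 0" using ip_cnj[of "u i" "eM a"] by simp
    qed
    have w_orth: "orthonormal w ?I"
      unfolding orthonormal_def
    proof (intro ballI)
      fix s t assume st: "s \<in> ?I" "t \<in> ?I"
      have "ip (eM a) (eM b) = (if a = b then 1 else 0)" if "a \<in> zB" "b \<in> zB" for a b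
        using eM that unfolding onb_def orthonormal_def by blast
      moreover have "ip (u i) (u j) = (if i = j then 1 else 0)" if "i \<le> N" "j \<le> N" for i j
        using u_orth that by (simp add: orthonormal_def)
      ultimately show "ip (w s) (w t) = (if s = t then 1 else 0)"
        using st M_u by (elim UnE imageE) (simp_all add: w_def)
    qed
    have w_keys: "keys (w i) \<subseteq> B" if "i \<in> ?I" for i
    proof -
      have YB: "{1..n1} \<times> {0..n2} \<union> {0..n1} \<times> {1..n2} \<subseteq> B"
        by (auto simp: defs)
      have "keys (u j) \<subseteq> B" for j
        using keys_p order_trans[OF kY YB] by (simp add: u_def B_def)
      moreover have "keys (eM a) \<subseteq> B" if "a \<in> zB" for a
        using kM[OF that] sub by blast
      ultimately show ?thesis using that by (elim UnE imageE) (simp_all add: w_def)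
    qed
    have "card ?I = card zB + Suc N"
      using fin by (subst card_Un_disjoint) (auto simp: card_image)
    also have "\<dots> = card B"
      using n1_nonneg n2_nonneg
      by (auto simp: defs card_cartesian_product N_def nat_add_distrib algebra_simps)
    finally have "proj w ?I x = x"
      using fin kx w_orth w_keys by (intro orthonormal_complete[of B]) auto
    moreover have "proj w ?I x = proj w (Inl ` zB) x + proj w (Inr ` {..N}) x"
      unfolding proj_def using fin by (intro sum.union_disjoint) auto
    moreover have "proj w (Inl ` zB) x = 0"
      unfolding proj_def using x0[OF kM] by (subst sum.reindex) (auto simp: w_def)
    moreover have "proj w (Inr ` {..N}) x = (\<Sum>j\<le>N. const (ip x (u j)) * u j)"
      unfolding proj_def by (subst sum.reindex) (auto simp: w_def)
    moreover have "\<dots> = (\<Sum>j<N. const (ip x (Y j)) * Y j) + const (ip x p) * p"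
      unfolding lessThan_Suc_atMost[symmetric] by (simp add: u_def)
    ultimately show ?thesis by (simp add: add.commute)
  qed
  show ?thesis
  proof
    fix i assume i: "i < N"
    show "X i = const (ip (X i) p) * p + (\<Sum>j<N. const (ip (X i) (Y j)) * (Z j * X j))"
      using expand[OF kX[OF i] X_zB[OF i]] by (simp add: Y_def)
  next
    have "ip pt y = 0" if "keys y \<subseteq> zB" for y
      using pt_zB[OF that] ip_cnj[of pt y] by simp
    then show "pt = const (ip pt p) * p + (\<Sum>j<N. const (ip pt (Y j)) * (Z j * X j))"
      using expand[of pt] keys_pt by (simp add: Y_def B_def)
  next
    fix v :: "nat \<Rightarrow> complex"
    \<comment> \<open>The coefficients are conjugated because \<open>ip\<close> is antilinear in its
      second argument: \<open>ip (X i) y\<close> is then entry \<open>i\<close> of K v.\<close>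
    define y where "y = (\<Sum>j<N. const (cnj (v j)) * Y j)"
    have "(\<Sum>i<N. (cmod (\<Sum>j<N. ip (X i) (Y j) * v j))\<^sup>2) = (\<Sum>i<N. (cmod (ip y (X i)))\<^sup>2)"
    proof (intro sum.cong refl)
      fix i
      have "(\<Sum>j<N. ip (X i) (Y j) * v j) = ip (X i) y"
        unfolding y_def ip_sum_right ip_const_right by (simp add: mult.commute)
      then show "(cmod (\<Sum>j<N. ip (X i) (Y j) * v j))\<^sup>2 = (cmod (ip y (X i)))\<^sup>2"
        using ip_cnj[of y "X i"] by simp
    qed
    also have "\<dots> \<le> nm y" by (rule bessel[OF _ X_orth]) simp
    also have "nm y = (\<Sum>j<N. (cmod (v j))\<^sup>2)"
      unfolding y_def by (subst nm_orthonormal_sum[OF _ Y_orth]) auto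
    finally show "(\<Sum>i<N. (cmod (\<Sum>j<N. ip (X i) (Y j) * v j))\<^sup>2) \<le> (\<Sum>j<N. (cmod (v j))\<^sup>2)" .
  qed
qed

end

section \<open>The Bernstein--Szego form of a stable polynomial\<close>

text \<open>Split off a root r of the characteristic polynomial. The sequence filtered by the
  cofactor is multiplied by r at each step, and |r| > 1 forces a bounded such sequence to vanish;
  the original sequence then satisfies the recurrence of the cofactor.\<close>

lemma bounded_recurrence:
  fixes q :: "complex poly" and \<tau> :: "nat \<Rightarrow> complex"
  assumes "\<And>z. poly q z = 0 \<Longrightarrow> 1 < cmod z" "bounded (range \<tau>)"
    and "\<And>m. (\<Sum>l\<le>degree q. coeff q l * \<tau> (m + l)) = 0"
  shows "\<tau> m = 0"
  using assms
proof (induction "degree q" arbitrary: q m)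
  case 0
  then obtain c where c: "q = [:c:]" by (metis degree_eq_zeroE)
  then have "c \<noteq> 0" using 0(2)[of 0] by auto
  then show ?case using 0(4)[of m] c by simp
next
  case (Suc d)
  have "\<not> constant (poly q)" using Suc(2) by (simp add: constant_degree)
  then obtain r where r: "poly q r = 0" using fundamental_theorem_of_algebra by blast
  then obtain q' where q': "q = [:- r, 1:] * q'" by (auto simp: poly_eq_0_iff_dvd)
  have r1: "1 < cmod r" using Suc(3)[OF r] .
  have "q' \<noteq> 0" using q' Suc(2) by auto
  then have deg: "degree q = Suc (degree q')" unfolding q' by (subst degree_mult_eq) auto
  define \<sigma> where "\<sigma> m = (\<Sum>l\<le>degree q'. coeff q' l * \<tau> (m + l))" for m
  have step: "\<sigma> (Suc m) = r * \<sigma> m" for m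
  proof -
    have "0 = (\<Sum>l\<le>Suc (degree q'). coeff (pCons 0 q') l * \<tau> (m + l))
        - r * (\<Sum>l\<le>Suc (degree q'). coeff q' l * \<tau> (m + l))"
    proof -
      have "coeff q l = coeff (pCons 0 q') l - r * coeff q' l" for l by (simp add: q')
      then show ?thesis using Suc(5)[of m] unfolding deg
        by (simp add: left_diff_distrib sum_subtractf sum_distrib_left mult.assoc del: sum.atMost_Suc)
    qed
    also have "(\<Sum>l\<le>Suc (degree q'). coeff (pCons 0 q') l * \<tau> (m + l)) = \<sigma> (Suc m)"
      by (subst sum.atMost_Suc_shift) (simp add: \<sigma>_def)
    also have "(\<Sum>l\<le>Suc (degree q'). coeff q' l * \<tau> (m + l)) = \<sigma> m"
      by (simp add: \<sigma>_def coeff_eq_0)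
    finally show ?thesis by simp
  qed
  have "\<sigma> m = 0" for m
  proof (rule ccontr)
    assume nz: "\<sigma> m \<noteq> 0"
    have pow: "\<sigma> (m + k) = r ^ k * \<sigma> m" for k by (induction k) (auto simp: step)
    obtain B where B: "\<And>n. cmod (\<tau> n) \<le> B" using Suc(4) by (auto simp: bounded_iff)
    define C where "C = (\<Sum>l\<le>degree q'. cmod (coeff q' l) * B)"
    have C: "cmod (\<sigma> n) \<le> C" for n
      unfolding \<sigma>_def C_def
      by (rule sum_norm_le) (auto simp: norm_mult intro!: mult_left_mono B)
    obtain k where "C / cmod (\<sigma> m) < cmod r ^ k" using real_arch_pow[OF r1] by blast
    then have "C < cmod (r ^ k * \<sigma> m)" using nz by (simp add: norm_mult norm_power field_simps)
    then have "C < cmod (\<sigma> (m + k))" by (simp only: pow)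
    then show False using C[of "m + k"] by simp
  qed
  then show ?case
    using Suc(2) deg r Suc(3,4) by (intro Suc(1)[of q']) (auto simp: q' \<sigma>_def)
qed

section \<open>Normalised means over the circle and the torus\<close>

definition circ :: "real \<Rightarrow> complex" where
  "circ t = exp (2 * of_real pi * \<i> * of_real t)"

lemma norm_circ [simp]: "cmod (circ t) = 1"
  by (simp add: circ_def)

lemma circ_nz [simp]: "circ t \<noteq> 0"
  by (simp add: circ_def)

lemma continuous_on_circ [continuous_intros]:
  "continuous_on S f \<Longrightarrow> continuous_on S (\<lambda>x. circ (f x))"
  unfolding circ_def by (intro continuous_intros)

text \<open>Cauchy's integral formula at the centre: the derivative of the parametrisation cancels
  1/u up to the factor 2 pi i.\<close>

lemma mean_value_circ:
  assumes "continuous_on (cball 0 1) h" "h holomorphic_on ball 0 1"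
  shows "integral {0..1} (\<lambda>t. h (circ t)) = h 0"
proof -
  have "((\<lambda>u. h u / (u - 0)) has_contour_integral (2 * of_real pi * \<i> * h 0)) (circlepath 0 1)"
    using assms by (intro Cauchy_integral_circlepath) auto
  then have "((\<lambda>t. h (circ t) / circ t * vector_derivative (circlepath 0 1) (at t within {0..1}))
      has_integral (2 * of_real pi * \<i> * h 0)) {0..1}"
    by (simp add: has_contour_integral_def circlepath circ_def)
  then have H: "((\<lambda>t. (2 * of_real pi * \<i>) * h (circ t)) has_integral ((2 * of_real pi * \<i>) * h 0)) {0..1}"
  proof (rule has_integral_eq[rotated])
    fix t :: real assume "t \<in> {0..1}"
    then have "vector_derivative (circlepath 0 1) (at t within {0..1}) = 2 * of_real pi * \<i> * circ t"
      by (simp add: vector_derivative_circlepath01 circ_def)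
    then show "h (circ t) / circ t * vector_derivative (circlepath 0 1) (at t within {0..1})
        = (2 * of_real pi * \<i>) * h (circ t)" by simp
  qed
  have cancel: "(f has_integral y) {0..1}"
    if "((\<lambda>t. c * f t) has_integral (c * y)) {0..1}" "c \<noteq> 0" for f y and c :: complex
    using has_integral_mult_right[OF that(1), of "inverse c"] that(2)
    by (simp flip: mult.assoc)
  from cancel[OF H] have "((\<lambda>t. h (circ t)) has_integral h 0) {0..1}" by simp
  then show ?thesis by (rule integral_unique)
qed

definition torus_mean :: "(complex \<Rightarrow> complex \<Rightarrow> complex) \<Rightarrow> complex" where
  "torus_mean f = integral (cbox (0, 0) (1, 1)) (\<lambda>(s, t). f (circ s) (circ t))"

definition torus_cont :: "(complex \<Rightarrow> complex \<Rightarrow> complex) \<Rightarrow> bool" where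
  "torus_cont f \<longleftrightarrow> continuous_on UNIV (\<lambda>(s, t). f (circ s) (circ t))"

lemma torus_integrable: "torus_cont f \<Longrightarrow> (\<lambda>(s, t). f (circ s) (circ t)) integrable_on cbox (0, 0) (1, 1)"
  unfolding torus_cont_def by (intro integrable_continuous) (auto elim: continuous_on_subset)

lemma torus_mean_iterated:
  assumes "torus_cont f"
  shows "torus_mean f = integral {0..1} (\<lambda>s. integral {0..1} (\<lambda>t. f (circ s) (circ t)))"
  unfolding torus_mean_def using assms
  by (subst integral_prod_continuous)
     (auto simp: torus_cont_def cbox_interval elim: continuous_on_subset)

lemma torus_mean_add:
  assumes "torus_cont f" "torus_cont g"
  shows "torus_mean (\<lambda>z w. f z w + g z w) = torus_mean f + torus_mean g"
  unfolding torus_mean_def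
  using integral_add[OF assms[THEN torus_integrable]] by (simp add: case_prod_unfold)

lemma torus_mean_mult: "torus_mean (\<lambda>z w. c * f z w) = c * torus_mean f"
  unfolding torus_mean_def
  using integral_mult_right[of "cbox (0, 0) (1, 1)" c "\<lambda>(s, t). f (circ s) (circ t)"]
  by (simp add: case_prod_unfold)

lemma torus_mean_cnj: "torus_mean (\<lambda>z w. cnj (f z w)) = cnj (torus_mean f)"
  unfolding torus_mean_def by (simp add: case_prod_unfold flip: integral_cnj)

lemma torus_mean_cong:
  assumes "\<And>z w. cmod z = 1 \<Longrightarrow> cmod w = 1 \<Longrightarrow> f z w = g z w"
  shows "torus_mean f = torus_mean g"
  unfolding torus_mean_def using assms by (intro integral_cong) auto

lemma torus_mean_Re_mono:
  assumes "torus_cont f" "torus_cont g"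
    and "\<And>z w. cmod z = 1 \<Longrightarrow> cmod w = 1 \<Longrightarrow> Re (f z w) \<le> Re (g z w)"
  shows "Re (torus_mean f) \<le> Re (torus_mean g)"
proof -
  have i: "(\<lambda>x. Re (case x of (s, t) \<Rightarrow> h (circ s) (circ t))) integrable_on cbox (0, 0) (1, 1)"
    "Re (torus_mean h) = integral (cbox (0, 0) (1, 1)) (\<lambda>x. Re (case x of (s, t) \<Rightarrow> h (circ s) (circ t)))"
    if "torus_cont h" for h
    using has_integral_Re[OF integrable_integral[OF torus_integrable[OF that]]]
    by (auto simp: torus_mean_def has_integral_iff)
  show ?thesis
    unfolding i(2)[OF assms(1)] i(2)[OF assms(2)]
    by (intro integral_le i assms) (auto simp: assms)
qed

lemma torus_cont_ev: "torus_cont (\<lambda>z w. ev z w x)"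
  unfolding torus_cont_def ev_def case_prod_unfold by (intro continuous_intros) auto

lemma torus_mean_zpow: "torus_mean (\<lambda>z w. z powi i * w powi j) = (if i = 0 \<and> j = 0 then 1 else 0)"
proof -
  have pos: "integral {0..1} (\<lambda>t. circ t powi k) = 0" if "k > 0" for k
  proof -
    have "integral {0..1} (\<lambda>t. circ t ^ nat k) = 0 ^ nat k"
      by (rule mean_value_circ) (auto intro!: continuous_intros holomorphic_intros)
    then show ?thesis using that by (simp add: power_int_def)
  qed
  have neg: "circ t powi k = cnj (circ t powi (- k))" for t k
  proof -
    have "cnj (circ t) = inverse (circ t)" by (simp add: circ_def exp_cnj flip: exp_minus)
    then show ?thesis by (simp add: cnj_power_int power_int_minus power_int_inverse)
  qed
  have *: "integral {0..1} (\<lambda>t. circ t powi k) = (if k = 0 then 1 else 0)" for k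
  proof (cases "k < 0")
    case True
    have "integral {0..1} (\<lambda>t. circ t powi k) = integral {0..1} (\<lambda>t. cnj (circ t powi (- k)))"
      by (intro integral_cong neg)
    also have "\<dots> = cnj (integral {0..1} (\<lambda>t. circ t powi (- k)))" by (rule integral_cnj[symmetric])
    finally show ?thesis using pos[of "- k"] True by simp
  next
    case False
    then show ?thesis using pos[of k] by auto
  qed
  have "torus_cont (\<lambda>z w. z powi i * w powi j)"
    using torus_cont_ev[of "zpow i j"] by (simp add: ev_single)
  then show ?thesis by (simp add: torus_mean_iterated *)
qed

lemma torus_mean_sum:
  assumes "finite A" "\<And>a. a \<in> A \<Longrightarrow> torus_cont (f a)"
  shows "torus_cont (\<lambda>z w. \<Sum>a\<in>A. f a z w) \<and> torus_mean (\<lambda>z w. \<Sum>a\<in>A. f a z w) = (\<Sum>a\<in>A. torus_mean (f a))"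
  using assms
proof (induction A rule: finite_induct)
  case empty
  then show ?case by (simp add: torus_mean_def torus_cont_def case_prod_unfold)
next
  case (insert a A)
  then show ?case
    by (auto simp: torus_mean_add torus_cont_def case_prod_unfold intro!: continuous_intros)
qed

lemma torus_mean_ev: "torus_mean (\<lambda>z w. ev z w x) = lookup x 0"
proof -
  have c: "torus_cont (\<lambda>z w. lookup x a * (z powi fst a * w powi snd a))" for a
    using torus_cont_ev[of "single a (lookup x a)"] by (simp add: ev_single)
  have "torus_mean (\<lambda>z w. ev z w x) = (\<Sum>a\<in>keys x. lookup x a * (if fst a = 0 \<and> snd a = 0 then 1 else 0))"
    unfolding ev_def
    using torus_mean_sum[of "keys x" "\<lambda>a z w. lookup x a * (z powi fst a * w powi snd a)"] c
    by (simp add: torus_mean_mult torus_mean_zpow)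
  also have "\<dots> = (\<Sum>a\<in>keys x. if a = 0 then lookup x 0 else 0)"
    by (intro sum.cong) (auto simp: zero_prod_def prod_eq_iff)
  also have "\<dots> = lookup x 0" by (simp add: in_keys_iff)
  finally show ?thesis .
qed

lemma ev_nat:
  assumes "keys x \<subseteq> {0..} \<times> {0..}"
  shows "ev z w x = (\<Sum>a\<in>keys x. lookup x a * (z ^ nat (fst a) * w ^ nat (snd a)))"
  unfolding ev_def using assms by (intro sum.cong) (auto simp: power_int_def)

lemma stable_form:
  fixes p :: laurent and n1 n2 :: int
  assumes n: "0 \<le> n1" "0 \<le> n2" and keys: "keys p \<subseteq> {0..n1} \<times> {0..n2}"
    and stable: "\<And>z w. cmod z \<le> 1 \<Longrightarrow> cmod w \<le> 1 \<Longrightarrow> ev z w p \<noteq> 0"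
  obtains L dl Cu where "bernstein_szego L dl Cu p n1 n2"
proof -
  define W where "W z w = complex_of_real (1 / (cmod (ev z w p))\<^sup>2)" for z w
  define L where "L x = torus_mean (\<lambda>z w. ev z w x * W z w)" for x
  have kp: "keys p \<subseteq> {0..} \<times> {0..}" using keys by auto
  have Wcont: "continuous_on UNIV (\<lambda>x. W (circ (fst x)) (circ (snd x)))"
    unfolding W_def using torus_cont_ev[of p] stable
    by (auto simp: torus_cont_def case_prod_unfold intro!: continuous_intros)
  have cont: "torus_cont (\<lambda>z w. ev z w x * W z w)" for x
    using torus_cont_ev[of x] Wcont
    by (auto simp: torus_cont_def case_prod_unfold intro!: continuous_intros)
  have L_add: "L (x + y) = L x + L y" for x y
    unfolding L_def using torus_mean_add[OF cont[of x] cont[of y]] by (simp add: ev_add distrib_right)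
  have nz: "z \<noteq> 0" if "cmod z = 1" for z :: complex using that by auto
  have ev_c: "ev z w (const c * x) = c * ev z w x" if "z \<noteq> 0" "w \<noteq> 0" for z w c x
    using that by (simp add: ev_mult)
  have L_const: "L (const c * x) = c * L x" for c x
    unfolding L_def torus_mean_mult[symmetric]
    by (rule torus_mean_cong) (simp add: ev_c nz mult.assoc)
  have L_zero: "L 0 = 0" using L_const[of 0 0] by simp
  have L_sum: "L (sum f A) = (\<Sum>a\<in>A. L (f a))" for f :: "'a \<Rightarrow> laurent" and A
    by (induction A rule: infinite_finite_induct) (auto simp: L_add L_zero)
  have L_star: "L (star x) = cnj (L x)" for x
    unfolding L_def torus_mean_cnj[symmetric]
    by (rule torus_mean_cong) (simp add: ev_star_torus W_def)
  have ev_p: "ev z w p \<noteq> 0" if "cmod z = 1" "cmod w = 1" for z w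
    using stable that by simp
  have mult_star: "ev z w (x * star x) = complex_of_real ((cmod (ev z w x))\<^sup>2)"
    if "cmod z = 1" "cmod w = 1" for z w x
    unfolding complex_norm_square using that nz by (simp add: ev_mult ev_star_torus)
  have W_p: "ev z w (x * star p) * W z w = ev z w x / ev z w p" if "cmod z = 1" "cmod w = 1" for z w x
  proof -
    have "W z w = 1 / (ev z w p * cnj (ev z w p))" by (simp only: W_def of_real_divide of_real_1 complex_norm_square)
    then show ?thesis using that nz ev_p[OF that] by (simp add: ev_mult ev_star_torus)
  qed
  \<comment> \<open>\<open>G\<close> is the set of values of |p| on the torus. It is compact, and
    its extreme values \<open>lo\<close> and \<open>hi\<close> give the constants
    \<open>1 / hi\<^sup>2\<close> and \<open>1 / lo\<^sup>2\<close> of the form.\<close>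
  define G where "G = (\<lambda>x. cmod (ev (circ (fst x)) (circ (snd x)) p)) ` cbox (0, 0 :: real) (1, 1 :: real)"
  have circ_ex: "\<exists>t\<in>{0..1}. z = circ t" if "cmod z = 1" for z
  proof -
    have "z \<in> path_image (circlepath 0 1)" using that by (simp add: path_image_circlepath)
    then show ?thesis by (auto simp: path_image_def circlepath circ_def)
  qed
  have Gin: "cmod (ev z w p) \<in> G" if zw: "cmod z = 1" "cmod w = 1" for z w
  proof -
    obtain s t where "s \<in> {0..1}" "z = circ s" "t \<in> {0..1}" "w = circ t" using circ_ex zw by metis
    then show ?thesis unfolding G_def by (intro image_eqI[of _ _ "(s, t)"]) auto
  qed
  have "compact G"
    unfolding G_def using torus_cont_ev[of p]
    by (intro compact_continuous_image continuous_intros)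
       (auto simp: torus_cont_def case_prod_unfold elim: continuous_on_subset)
  moreover have "G \<noteq> {}" using Gin[of 1 1] by auto
  ultimately obtain lo hi where lo: "lo \<in> G" "\<forall>g\<in>G. lo \<le> g" and hi: "hi \<in> G" "\<forall>g\<in>G. g \<le> hi"
    using compact_attains_inf compact_attains_sup by metis
  have lo_pos: "lo > 0" using lo(1) ev_p by (auto simp: G_def)
  have hi_pos: "hi > 0" using lo_pos lo(1) hi(2) by force
  have W_bounds: "1 / hi\<^sup>2 \<le> 1 / (cmod (ev z w p))\<^sup>2" "1 / (cmod (ev z w p))\<^sup>2 \<le> 1 / lo\<^sup>2"
    if "cmod z = 1" "cmod w = 1" for z w
    using Gin[OF that] lo hi lo_pos hi_pos ev_p[OF that]
    by (auto intro!: divide_left_mono power_mono mult_pos_pos zero_less_power)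
  have nrm: "torus_mean (\<lambda>z w. c * ev z w (x * star x)) = c * complex_of_real (nrm2 x)" for c x
    by (simp add: torus_mean_mult torus_mean_ev lookup_mult_star_self)
  have contc: "torus_cont (\<lambda>z w. complex_of_real c * ev z w x)" for c x
    using torus_cont_ev[of x] by (auto simp: torus_cont_def case_prod_unfold intro!: continuous_intros)
  have lower: "1 / hi\<^sup>2 * nrm2 x \<le> Re (L (x * star x))" for x
  proof -
    have "Re (torus_mean (\<lambda>z w. complex_of_real (1 / hi\<^sup>2) * ev z w (x * star x))) \<le> Re (L (x * star x))"
      unfolding L_def
      by (rule torus_mean_Re_mono[OF contc cont])
         (simp only: mult_star W_def flip: of_real_mult, simp only: Re_complex_of_real mult.commute[of "1 / hi\<^sup>2"],
          intro mult_left_mono W_bounds, auto)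
    then show ?thesis by (simp only: nrm flip: of_real_mult) simp
  qed
  have upper: "Re (L (x * star x)) \<le> 1 / lo\<^sup>2 * nrm2 x" for x
  proof -
    have "Re (L (x * star x)) \<le> Re (torus_mean (\<lambda>z w. complex_of_real (1 / lo\<^sup>2) * ev z w (x * star x)))"
      unfolding L_def
      by (rule torus_mean_Re_mono[OF cont contc])
         (simp only: mult_star W_def flip: of_real_mult, simp only: Re_complex_of_real mult.commute[of "1 / lo\<^sup>2"],
          intro mult_left_mono W_bounds, auto)
    then show ?thesis by (simp only: nrm flip: of_real_mult) simp
  qed
  interpret laurent_form L "1 / hi\<^sup>2" "1 / lo\<^sup>2"
    by unfold_locales (use L_add L_const L_star lower upper hi_pos in auto)
  \<comment> \<open>The integrand is z^i w^j / p. For fixed z on the circle it is holomorphic in w,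
    so the inner mean is its value at w = 0, which vanishes if j > 0. If j = 0, what remains is the
    mean of z^i / p(z,0), equal to its value 0 at z = 0.\<close>
  have mono_orth: "L (zpow i j * star p) = 0" if ij: "j > 0 \<or> j = 0 \<and> i > 0" for i j
  proof -
    let ?f = "\<lambda>z w. z powi i * w powi j / ev z w p"
    have c: "torus_cont ?f"
      using torus_cont_ev[of "zpow i j"] torus_cont_ev[of p] stable
      by (auto simp: torus_cont_def ev_single case_prod_unfold intro!: continuous_intros)
    have j0: "j \<ge> 0" using ij by auto
    have inner: "integral {0..1} (\<lambda>t. ?f z (circ t)) = z powi i * 0 powi j / ev z 0 p" if "cmod z = 1" for z
    proof -
      have "integral {0..1} (\<lambda>t. z powi i * circ t ^ nat j / ev z (circ t) p) = z powi i * 0 ^ nat j / ev z 0 p"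
      proof (rule mean_value_circ)
        show "continuous_on (cball 0 1) (\<lambda>w. z powi i * w ^ nat j / ev z w p)"
          unfolding ev_nat[OF kp] using stable that
          by (intro continuous_intros) (auto simp flip: ev_nat[OF kp])
        show "(\<lambda>w. z powi i * w ^ nat j / ev z w p) holomorphic_on ball 0 1"
          unfolding ev_nat[OF kp] using stable that
          by (intro holomorphic_intros) (auto simp flip: ev_nat[OF kp])
      qed
      then show ?thesis using j0 by (simp add: power_int_def)
    qed
    have "L (zpow i j * star p) = torus_mean ?f"
      unfolding L_def by (rule torus_mean_cong) (simp add: W_p, simp add: ev_single)
    also have "\<dots> = integral {0..1} (\<lambda>s. circ s powi i * 0 powi j / ev (circ s) 0 p)"
      unfolding torus_mean_iterated[OF c] by (simp add: inner)
    also have "\<dots> = 0"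
    proof (cases "j > 0")
      case False
      then have i: "i > 0" "j = 0" using ij by auto
      have "integral {0..1} (\<lambda>s. circ s ^ nat i / ev (circ s) 0 p) = 0 ^ nat i / ev 0 0 p"
      proof (rule mean_value_circ)
        show "continuous_on (cball 0 1) (\<lambda>z. z ^ nat i / ev z 0 p)"
          unfolding ev_nat[OF kp] using stable
          by (intro continuous_intros) (auto simp flip: ev_nat[OF kp])
        show "(\<lambda>z. z ^ nat i / ev z 0 p) holomorphic_on ball 0 1"
          unfolding ev_nat[OF kp] using stable
          by (intro holomorphic_intros) (auto simp flip: ev_nat[OF kp])
      qed
      then show ?thesis using i by (simp add: power_int_def)
    qed (simp add: power_int_0_left_if)
    finally show ?thesis .
  qed
  have orth: "ip x p = 0" if "\<And>a. a \<in> Poly_Mapping.keys x \<Longrightarrow> snd a > 0 \<or> snd a = 0 \<and> fst a > 0" for x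
  proof -
    have "x = (\<Sum>a\<in>Poly_Mapping.keys x. const (lookup x a) * zpow (fst a) (snd a))"
      using sum_monomials[of "Poly_Mapping.keys x" x] by (simp add: mult_single)
    then have "ip x p = (\<Sum>a\<in>Poly_Mapping.keys x. lookup x a * ip (zpow (fst a) (snd a)) p)"
      by (metis (no_types, lifting) ip_const_left ip_sum_left sum.cong)
    also have "\<dots> = 0" using mono_orth that by (intro sum.neutral) (auto simp: ip_def)
    finally show ?thesis .
  qed
  have pp: "ip (x * p) p = lookup x 0" for x
  proof -
    have "ip (x * p) p = torus_mean (\<lambda>z w. ev z w x)"
      unfolding ip_def L_def using ev_p nz by (intro torus_mean_cong) (simp add: W_p, simp add: ev_mult)
    then show ?thesis by (simp add: torus_mean_ev)
  qed
  have rec: "\<tau> m = 0" if b: "bounded (range \<tau>)"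
    and r: "\<And>m. (\<Sum>l\<le>nat n1. cnj (lookup p (int l, 0)) * \<tau> (m + l)) = 0" for \<tau> :: "nat \<Rightarrow> complex" and m
  proof -
    \<comment> \<open>The value of \<open>q\<close> at z is the conjugate of p(cnj z, 0), so by
      stability its roots lie outside the closed disk.\<close>
    define q where "q = (\<Sum>l\<le>nat n1. monom (cnj (lookup p (int l, 0))) l)"
    have cq: "coeff q l = (if l \<le> nat n1 then cnj (lookup p (int l, 0)) else 0)" for l
      by (simp add: q_def coeff_sum)
    have dq: "degree q \<le> nat n1" by (rule degree_le) (auto simp: cq)
    have "poly q z = cnj (ev (cnj z) 0 p)" for z
    proof -
      have inj: "inj_on (\<lambda>l. (int l, 0 :: int)) {..nat n1}" by (auto intro: inj_onI)
      have "ev (cnj z) 0 p = (\<Sum>a\<in>{0..n1} \<times> {0..n2}. lookup p a * (cnj z powi fst a * 0 powi snd a))"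
        using keys by (intro ev_eq) auto
      also have "\<dots> = (\<Sum>a\<in>(\<lambda>l. (int l, 0)) ` {..nat n1}. lookup p a * (cnj z powi fst a * 0 powi snd a))"
      proof (rule sum.mono_neutral_right)
        show "(\<lambda>l. (int l, 0)) ` {..nat n1} \<subseteq> {0..n1} \<times> {0..n2}" using n by auto
        show "\<forall>a\<in>{0..n1} \<times> {0..n2} - (\<lambda>l. (int l, 0)) ` {..nat n1}.
            lookup p a * (cnj z powi fst a * 0 powi snd a) = 0"
        proof
          fix a assume a: "a \<in> {0..n1} \<times> {0..n2} - (\<lambda>l. (int l, 0)) ` {..nat n1}"
          have "snd a \<noteq> 0"
          proof
            assume "snd a = 0"
            then have "a = (int (nat (fst a)), 0)" using a by (auto simp: prod_eq_iff)
            moreover have "nat (fst a) \<le> nat n1" using a by auto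
            ultimately have "a \<in> (\<lambda>l. (int l, 0)) ` {..nat n1}" by blast
            then show False using a by blast
          qed
          then show "lookup p a * (cnj z powi fst a * 0 powi snd a) = 0"
            by (simp add: power_int_0_left_if)
        qed
      qed auto
      also have "\<dots> = (\<Sum>l\<le>nat n1. lookup p (int l, 0) * cnj z ^ l)"
        by (subst sum.reindex[OF inj]) simp
      finally show ?thesis by (simp add: q_def poly_sum poly_monom)
    qed
    then have roots: "1 < cmod z" if "poly q z = 0" for z
      using stable[of "cnj z" 0] that by (cases "cmod z \<le> 1") auto
    have "(\<Sum>l\<le>degree q. coeff q l * \<tau> (m + l)) = 0" for m
    proof -
      have "(\<Sum>l\<le>degree q. coeff q l * \<tau> (m + l)) = (\<Sum>l\<le>nat n1. coeff q l * \<tau> (m + l))"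
        using dq by (intro sum.mono_neutral_left) (auto simp: coeff_eq_0)
      also have "\<dots> = 0" using r[of m] by (simp add: cq)
      finally show ?thesis .
    qed
    from bounded_recurrence[OF roots b this] show ?thesis .
  qed
  have "bernstein_szego L (1 / hi\<^sup>2) (1 / lo\<^sup>2) p n1 n2"
    by unfold_locales (use n keys orth pp rec in auto)
  then show ?thesis by (rule that)
qed

section \<open>Determinantal representation of stable polynomials\<close>

text \<open>Slices of determinants and adjugates are treated as functions with a degree bound, so
  that matrices keep complex entries instead of polynomial ones.\<close>

definition polyfun :: "(complex \<Rightarrow> complex) \<Rightarrow> nat \<Rightarrow> bool" where
  "polyfun f n \<longleftrightarrow> (\<exists>q. degree q \<le> n \<and> (\<forall>w. f w = poly q w))"

lemma polyfun_const: "polyfun (\<lambda>w. c) n"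
  unfolding polyfun_def by (intro exI[of _ "[:c:]"]) auto

lemma polyfun_mono: "polyfun f m \<Longrightarrow> m \<le> n \<Longrightarrow> polyfun f n"
  unfolding polyfun_def by (meson order_trans)

lemma polyfun_id: "polyfun (\<lambda>w. w) 1"
  unfolding polyfun_def by (intro exI[of _ "[:0, 1:]"]) auto

lemma polyfun_mult: "polyfun f m \<Longrightarrow> polyfun g n \<Longrightarrow> polyfun (\<lambda>w. f w * g w) (m + n)"
  unfolding polyfun_def by (metis add_mono degree_mult_le order_trans poly_mult)

lemma polyfun_cmult: "polyfun f m \<Longrightarrow> polyfun (\<lambda>w. c * f w) m"
  using polyfun_mult[OF polyfun_const[of c 0], of f m] by simp

lemma polyfun_multc: "polyfun f m \<Longrightarrow> polyfun (\<lambda>w. f w * c) m"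
  using polyfun_cmult[of f m c] by (simp add: mult.commute)

lemma polyfun_add: "polyfun f n \<Longrightarrow> polyfun g n \<Longrightarrow> polyfun (\<lambda>w. f w + g w) n"
  unfolding polyfun_def by (metis degree_add_le poly_add)

lemma polyfun_diff: "polyfun f n \<Longrightarrow> polyfun g n \<Longrightarrow> polyfun (\<lambda>w. f w - g w) n"
  unfolding polyfun_def by (metis degree_diff_le poly_diff)

lemma polyfun_uminus: "polyfun f n \<Longrightarrow> polyfun (\<lambda>w. - f w) n"
  using polyfun_cmult[of f n "-1"] by simp

lemma polyfun_power: "polyfun (\<lambda>w. w ^ k) k"
  unfolding polyfun_def by (intro exI[of _ "monom 1 k"]) (auto simp: poly_monom degree_monom_le)

lemma polyfun_sum: "(\<And>a. a \<in> A \<Longrightarrow> polyfun (f a) n) \<Longrightarrow> polyfun (\<lambda>w. \<Sum>a\<in>A. f a w) n"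
  by (induction A rule: infinite_finite_induct) (auto intro: polyfun_const polyfun_add)

lemma polyfun_prod: "(\<And>a. a \<in> A \<Longrightarrow> polyfun (f a) (d a)) \<Longrightarrow> polyfun (\<lambda>w. \<Prod>a\<in>A. f a w) (sum d A)"
  by (induction A rule: infinite_finite_induct) (auto intro: polyfun_const polyfun_mult)

lemma polyfun_eq:
  assumes "polyfun f m" "polyfun g n" "infinite {w. f w = g w}"
  shows "f w = g w"
proof -
  obtain a b where ab: "\<And>w. f w = poly a w" "\<And>w. g w = poly b w"
    using assms unfolding polyfun_def by metis
  have "infinite {w. poly (a - b) w = 0}" using assms(3) by (simp add: ab)
  then have "a - b = 0" using poly_roots_finite by blast
  then show ?thesis using ab by simp
qed

text \<open>Each Leibniz term takes one entry from every column, so column bounds add up. For the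
  pencil this gives the partial degrees \<open>n1\<close> and \<open>n2\<close>, not just the total
  size.\<close>

lemma polyfun_det:
  assumes "\<And>w. A w \<in> carrier_mat n n" "\<And>i j. i < n \<Longrightarrow> j < n \<Longrightarrow> polyfun (\<lambda>w. A w $$ (i, j)) (d j)"
  shows "polyfun (\<lambda>w. Determinant.det (A w)) (\<Sum>j<n. d j)"
proof -
  have "Determinant.det (A w) = (\<Sum>\<pi> | \<pi> permutes {0..<n}. signof \<pi> * (\<Prod>j<n. A w $$ (\<pi> j, j)))" for w
    using det_col[OF assms(1)] .
  moreover have "\<pi> j < n" if "\<pi> permutes {0..<n}" "j < n" for \<pi> j
    using that permutes_in_image[of \<pi> "{0..<n}" j] by simp
  ultimately show ?thesis
    by (auto intro!: polyfun_sum polyfun_cmult polyfun_prod assms(2))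
qed

text \<open>Over the complex numbers, absence of common zeros is coprimality. Hence \<open>A\<close>
  divides \<open>D\<close>, and the degree bound leaves only a constant quotient.\<close>

lemma poly_coprime_quotient:
  fixes A B D R :: "complex poly"
  assumes eq: "B * D = A * R" and nocommon: "\<And>z. poly A z = 0 \<Longrightarrow> poly B z = 0 \<Longrightarrow> False"
    and deg: "degree D \<le> degree A"
  shows "\<exists>c. D = smult c A"
proof -
  have A0: "A \<noteq> 0 \<or> B \<noteq> 0" using nocommon[of 0] by auto
  have "coprime A B"
  proof (rule coprimeI)
    fix c assume c: "c dvd A" "c dvd B"
    then have "c \<noteq> 0" using A0 by auto
    moreover have "degree c = 0"
    proof (rule ccontr)
      assume "degree c \<noteq> 0"
      then have "\<not> constant (poly c)" by (simp add: constant_degree)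
      then obtain z where "poly c z = 0" using fundamental_theorem_of_algebra by blast
      then show False using c nocommon[of z] by (auto elim!: dvdE)
    qed
    ultimately show "is_unit c" by (simp add: is_unit_iff_degree)
  qed
  moreover have "A dvd B * D" using eq by simp
  ultimately have "A dvd D" by (simp add: coprime_dvd_mult_right_iff)
  then obtain Q where Q: "D = A * Q" by (elim dvdE)
  show ?thesis
  proof (cases "D = 0")
    case True
    then show ?thesis by (intro exI[of _ 0]) simp
  next
    case False
    then have "degree Q = 0" using deg unfolding Q by (subst (asm) degree_mult_eq) auto
    then obtain c where "Q = [:c:]" by (metis degree_eq_zeroE)
    then show ?thesis using Q by (intro exI[of _ c]) simp
  qed
qed

text \<open>The divisibility relation comes from evaluating Laurent polynomials and is given for w
  nonzero only; infinitely many points turn it into an identity of polynomials, to which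
  \<open>poly_coprime_quotient\<close> applies.\<close>

lemma slice_proportional:
  fixes q :: "complex poly" and Pt D R :: "complex \<Rightarrow> complex"
  assumes D: "polyfun D (degree q)" and Pt: "polyfun Pt m" and R: "polyfun R n"
    and eq: "\<And>w. w \<noteq> 0 \<Longrightarrow> Pt w * D w = poly q w * R w"
    and nocommon: "\<And>w. poly q w = 0 \<Longrightarrow> Pt w \<noteq> 0"
  shows "D w * poly q 0 = D 0 * poly q w"
proof -
  obtain d pt r where d: "degree d \<le> degree q" "\<And>w. D w = poly d w"
    and pt: "\<And>w. Pt w = poly pt w" and r: "\<And>w. R w = poly r w"
    using D Pt R unfolding polyfun_def by metis
  have "pt * d = q * r"
  proof -
    have "{w. w \<noteq> 0} \<subseteq> {w. poly (pt * d - q * r) w = 0}" using eq by (auto simp: d pt r)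
    moreover have "infinite {w :: complex. w \<noteq> 0}"
      using infinite_UNIV_char_0[where ?'a = complex] finite_insert[of 0 "{w :: complex. w \<noteq> 0}"]
      by (metis (mono_tags, lifting) UNIV_eq_I insertCI mem_Collect_eq)
    ultimately have "infinite {w. poly (pt * d - q * r) w = 0}" using infinite_super by blast
    then have "pt * d - q * r = 0" using poly_roots_finite by blast
    then show ?thesis by simp
  qed
  moreover have "\<And>z. poly q z = 0 \<Longrightarrow> poly pt z = 0 \<Longrightarrow> False" using nocommon by (simp add: pt)
  ultimately obtain c where "d = smult c q" using poly_coprime_quotient d(1) by metis
  then show ?thesis by (simp add: d)
qed

lemma infinite_circle_minus_roots:
  fixes t :: "complex poly" assumes "t \<noteq> 0"
  shows "infinite {z. cmod z = 1 \<and> poly t z \<noteq> 0}"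
proof
  assume "finite {z. cmod z = 1 \<and> poly t z \<noteq> 0}"
  then have "finite ({z. cmod z = 1 \<and> poly t z \<noteq> 0} \<union> {z. poly t z = 0})"
    using poly_roots_finite[OF assms] by simp
  then have "finite (sphere 0 1 :: complex set)" by (rule finite_subset[rotated]) auto
  moreover have "(\<lambda>x. Complex x (sqrt (1 - x\<^sup>2))) ` {0..1} \<subseteq> sphere 0 1"
    by (auto simp: cmod_def power_le_one)
  moreover have "inj_on (\<lambda>x. Complex x (sqrt (1 - x\<^sup>2))) {0..1}" by (auto intro: inj_onI)
  ultimately have "finite {0..1 :: real}" by (meson finite_imageD finite_subset)
  then show False using infinite_Icc[of 0 "1 :: real"] by simp
qed

section \<open>Slices of p and of the pencil I - KZ\<close>

lemma ev_double:
  assumes "keys x \<subseteq> {0..int n1} \<times> {0..int n2}"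
  shows "ev z w x = (\<Sum>i\<le>n1. \<Sum>j\<le>n2. lookup x (int i, int j) * (z ^ i * w ^ j))"
proof -
  have "ev z w x = (\<Sum>a\<in>{0..int n1} \<times> {0..int n2}. lookup x a * (z powi fst a * w powi snd a))"
    using assms by (intro ev_eq) auto
  also have "\<dots> = (\<Sum>(i, j)\<in>{..n1} \<times> {..n2}. lookup x (int i, int j) * (z ^ i * w ^ j))"
    by (rule sum.reindex_bij_witness[of _ "\<lambda>(i, j). (int i, int j)" "\<lambda>(i, j). (nat i, nat j)"])
       (auto simp: power_int_def)
  also have "\<dots> = (\<Sum>i\<le>n1. \<Sum>j\<le>n2. lookup x (int i, int j) * (z ^ i * w ^ j))"
    by (simp add: sum.cartesian_product)
  finally show ?thesis .
qed

lemma polyfun_ev_right: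
  assumes "keys x \<subseteq> {0..int n1} \<times> {0..int n2}" shows "polyfun (\<lambda>w. ev z w x) n2"
  unfolding ev_double[OF assms]
  by (intro polyfun_sum polyfun_cmult polyfun_mono[OF polyfun_power]) auto

lemma polyfun_ev_left:
  assumes "keys x \<subseteq> {0..int n1} \<times> {0..int n2}" shows "polyfun (\<lambda>z. ev z w x) n1"
proof -
  have "polyfun (\<lambda>z. \<Sum>i\<le>n1. \<Sum>j\<le>n2. lookup x (int i, int j) * (w ^ j * z ^ i)) n1"
    by (intro polyfun_sum polyfun_cmult polyfun_mono[OF polyfun_power]) auto
  then show ?thesis unfolding ev_double[OF assms] by (simp add: mult.commute)
qed

definition pencil :: "nat \<Rightarrow> nat \<Rightarrow> (nat \<Rightarrow> nat \<Rightarrow> complex) \<Rightarrow> complex \<Rightarrow> complex \<Rightarrow> complex mat" where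
  "pencil n1 n2 K z w = mat (n1 + n2) (n1 + n2)
     (\<lambda>(i, j). (if i = j then 1 else 0) - K i j * (if j < n1 then z else w))"

lemma pencil_carrier [simp]: "pencil n1 n2 K z w \<in> carrier_mat (n1 + n2) (n1 + n2)"
  by (simp add: pencil_def)

lemma polyfun_pencil_entry:
  assumes "i < n1 + n2" "j < n1 + n2"
  shows "polyfun (\<lambda>w. pencil n1 n2 K z w $$ (i, j)) (if j < n1 then 0 else 1)"
    and "polyfun (\<lambda>z. pencil n1 n2 K z w $$ (i, j)) (if j < n1 then 1 else 0)"
  using assms
  by (auto simp: pencil_def intro!: polyfun_const polyfun_diff polyfun_uminus polyfun_cmult polyfun_id[unfolded One_nat_def])

lemma polyfun_det_pencil_right: "polyfun (\<lambda>w. Determinant.det (pencil n1 n2 K z w)) n2"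
proof -
  have "(\<Sum>j<n1 + n2. if j < n1 then 0 else 1) = n2"
    by (induction n2) auto
  then show ?thesis
    using polyfun_det[OF pencil_carrier polyfun_pencil_entry(1), of n1 n2 K z] by simp
qed

lemma polyfun_det_pencil_left: "polyfun (\<lambda>z. Determinant.det (pencil n1 n2 K z w)) n1"
proof -
  have "(\<Sum>j<n1. if j < n1 then 1 else 0) = (\<Sum>j<n1. 1 :: nat)"
    by (intro sum.cong) auto
  then have "(\<Sum>j<n1 + n2. if j < n1 then 1 else 0) = n1"
    by (induction n2) auto
  then show ?thesis
    using polyfun_det[OF pencil_carrier polyfun_pencil_entry(2), of n1 n2 K w] by simp
qed

lemma adj_entry_polyfun:
  assumes A: "\<And>w. A w \<in> carrier_mat n n" and e: "\<And>i j. i < n \<Longrightarrow> j < n \<Longrightarrow> polyfun (\<lambda>w. A w $$ (i, j)) 1"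
    and ij: "i < n" "j < n"
  shows "polyfun (\<lambda>w. adj_mat (A w) $$ (i, j)) (n - 1)"
proof -
  have dims: "dim_row (A w) = n" "dim_col (A w) = n" for w using A[of w] by auto
  have c: "mat_delete (A w) j i \<in> carrier_mat (n - 1) (n - 1)" for w
    by (rule mat_delete_carrier[OF A])
  have "polyfun (\<lambda>w. Determinant.det (mat_delete (A w) j i)) (\<Sum>_<n - 1. 1)"
  proof (rule polyfun_det[OF c])
    fix k l assume kl: "k < n - 1" "l < n - 1"
    have "mat_delete (A w) j i $$ (k, l) = A w $$ (if k < j then k else Suc k, if l < i then l else Suc l)" for w
      using kl by (simp add: mat_delete_def dims)
    then show "polyfun (\<lambda>w. mat_delete (A w) j i $$ (k, l)) 1" using kl
      by (simp only:) (intro e, auto)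
  qed
  then have "polyfun (\<lambda>w. (-1) ^ (j + i) * Determinant.det (mat_delete (A w) j i)) (n - 1)"
    by (intro polyfun_cmult) simp
  then show ?thesis using ij by (simp add: adj_mat_def dims cofactor_def)
qed

lemma stable_representation:
  fixes p :: laurent and n1 n2 :: nat
  assumes keys: "keys p \<subseteq> {0..int n1} \<times> {0..int n2}"
    and stable: "\<And>z w. cmod z \<le> 1 \<Longrightarrow> cmod w \<le> 1 \<Longrightarrow> ev z w p \<noteq> 0"
    and p0: "lookup p 0 = 1"
    and deg1: "\<exists>j. lookup p (int n1, j) \<noteq> 0" and deg2: "\<exists>i. lookup p (i, int n2) \<noteq> 0"
  obtains K :: "nat \<Rightarrow> nat \<Rightarrow> complex" where
    "\<And>v. (\<Sum>i<n1 + n2. (cmod (\<Sum>j<n1 + n2. K i j * v j))\<^sup>2) \<le> (\<Sum>j<n1 + n2. (cmod (v j))\<^sup>2)"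
    "\<And>z w. ev z w p = Determinant.det (pencil n1 n2 K z w)"
proof -
  let ?N = "n1 + n2"
  obtain L dl Cu where "bernstein_szego L dl Cu p (int n1) (int n2)"
    using stable_form[of "int n1" "int n2" p] keys stable by auto
  then interpret bernstein_szego L dl Cu p "int n1" "int n2" .
  define Z where "Z = (\<lambda>j. if j < n1 then zpow 1 0 else zpow 0 1)"
  obtain X :: "nat \<Rightarrow> laurent" and K l b a where
    *: "(\<forall>i<?N. X i = const (l i) * p + (\<Sum>j<?N. const (K i j) * (Z j * X j))) \<and>
     pt = const a * p + (\<Sum>j<?N. const (b j) * (Z j * X j)) \<and>
     (\<forall>v. (\<Sum>i<?N. (cmod (\<Sum>j<?N. K i j * v j))\<^sup>2) \<le> (\<Sum>j<?N. (cmod (v j))\<^sup>2))"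
    (is "?P X K l b a")
  proof -
    show thesis
    proof (rule realization[unfolded nat_int])
      fix X K l b a
      let ?Z = "\<lambda>j. if j < n1 then zpow 1 0 else zpow 0 1"
      assume "\<And>i. i < ?N \<Longrightarrow> X i = const (l i) * p + (\<Sum>j<?N. const (K i j) * (?Z j * X j))"
        "pt = const a * p + (\<Sum>j<?N. const (b j) * (?Z j * X j))"
        "\<And>v. (\<Sum>i<?N. (cmod (\<Sum>j<?N. K i j * v j))\<^sup>2) \<le> (\<Sum>j<?N. (cmod (v j))\<^sup>2)"
      then have "?P X K l b a" unfolding Z_def by blast
      then show thesis by (rule that)
    qed
  qed
  note X = *[THEN conjunct1, rule_format] and pt = *[THEN conjunct2, THEN conjunct1]
    and contr = *[THEN conjunct2, THEN conjunct2, rule_format]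
  define D where "D z w = Determinant.det (pencil n1 n2 K z w)" for z w
  define adjl where "adjl z w i = (\<Sum>j<?N. adj_mat (pencil n1 n2 K z w) $$ (i, j) * l j)" for z w i
  define \<zeta> where "\<zeta> z w j = (if j < n1 then z else w)" for z w :: complex and j
  define R where "R z w = a * D z w + (\<Sum>j<?N. b j * \<zeta> z w j * adjl z w j)" for z w
  have evZ: "ev z w (Z j) = \<zeta> z w j" for z w j by (simp add: Z_def \<zeta>_def ev_single)
  \<comment> \<open>At a point the realization reads (I - KZ) X = p l; multiplying by the adjugate
    is Cramer's rule, valid also where the determinant vanishes.\<close>
  have DX: "D z w * ev z w (X i) = ev z w p * adjl z w i"
    if "z \<noteq> 0" "w \<noteq> 0" "i < ?N" for z w i
  proof -
    let ?A = "pencil n1 n2 K z w"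
    define x where "x = vec ?N (\<lambda>i. ev z w (X i))"
    define lv where "lv = vec ?N l"
    have A: "?A \<in> carrier_mat ?N ?N" by simp
    have adjA: "adj_mat ?A \<in> carrier_mat ?N ?N" using adj_mat(1)[OF A] .
    have "?A *\<^sub>v x = ev z w p \<cdot>\<^sub>v lv"
    proof (rule eq_vecI)
      fix i assume "i < dim_vec (ev z w p \<cdot>\<^sub>v lv)"
      then have i: "i < ?N" by (simp add: lv_def)
      have "(?A *\<^sub>v x) $ i = (\<Sum>j<?N. ((if i = j then 1 else 0) - K i j * \<zeta> z w j) * ev z w (X j))"
        using i by (simp add: pencil_def x_def scalar_prod_def \<zeta>_def lessThan_atLeast0)
      also have "\<dots> = (\<Sum>j<?N. (if i = j then ev z w (X j) else 0)) - (\<Sum>j<?N. K i j * \<zeta> z w j * ev z w (X j))"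
        unfolding sum_subtractf[symmetric] by (intro sum.cong) (auto simp: algebra_simps)
      also have "\<dots> = ev z w (X i) - (\<Sum>j<?N. K i j * \<zeta> z w j * ev z w (X j))" using i by simp
      also have "ev z w (X i) = l i * ev z w p + (\<Sum>j<?N. K i j * \<zeta> z w j * ev z w (X j))"
        by (subst X[OF i]) (use that in \<open>simp add: ev_add ev_mult ev_sum evZ mult.assoc\<close>)
      finally show "(?A *\<^sub>v x) $ i = (ev z w p \<cdot>\<^sub>v lv) $ i" using i by (simp add: lv_def)
    qed (simp add: lv_def pencil_def)
    then have "adj_mat ?A *\<^sub>v (?A *\<^sub>v x) = adj_mat ?A *\<^sub>v (ev z w p \<cdot>\<^sub>v lv)" by simp
    moreover have "adj_mat ?A *\<^sub>v (?A *\<^sub>v x) = D z w \<cdot>\<^sub>v x"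
    proof -
      have "adj_mat ?A *\<^sub>v (?A *\<^sub>v x) = (adj_mat ?A * ?A) *\<^sub>v x"
        by (rule assoc_mult_mat_vec[OF adjA A, symmetric]) (simp add: x_def)
      also have "\<dots> = (D z w \<cdot>\<^sub>m 1\<^sub>m ?N) *\<^sub>v x" by (simp add: adj_mat(3)[OF A] D_def)
      also have "\<dots> = D z w \<cdot>\<^sub>v x"
        by (rule eq_vecI) (auto simp: x_def scalar_prod_def if_distrib if_distribR cong: if_cong)
      finally show ?thesis .
    qed
    ultimately have "(D z w \<cdot>\<^sub>v x) $ i = (adj_mat ?A *\<^sub>v (ev z w p \<cdot>\<^sub>v lv)) $ i" by simp
    then show ?thesis
      using that(3) adjA
      by (simp add: x_def lv_def adjl_def scalar_prod_def sum_distrib_left mult_ac lessThan_atLeast0)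
  qed
  \<comment> \<open>Multiply the expansion of \<open>pt\<close> by \<open>D\<close> and replace each
    product of \<open>D\<close> and \<open>X j\<close> by means of \<open>DX\<close>: every term
    then contains the factor p.\<close>
  have key: "ev z w pt * D z w = ev z w p * R z w" if "z \<noteq> 0" "w \<noteq> 0" for z w
  proof -
    have "ev z w pt = a * ev z w p + (\<Sum>j<?N. b j * \<zeta> z w j * ev z w (X j))"
      by (subst pt) (use that in \<open>simp add: ev_add ev_mult ev_sum evZ mult.assoc\<close>)
    then have "ev z w pt * D z w = a * ev z w p * D z w + (\<Sum>j<?N. b j * \<zeta> z w j * (D z w * ev z w (X j)))"
      by (simp only: distrib_left sum_distrib_left mult_ac)
    also have "(\<Sum>j<?N. b j * \<zeta> z w j * (D z w * ev z w (X j))) = (\<Sum>j<?N. ev z w p * (b j * \<zeta> z w j * adjl z w j))"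
      using DX that by (intro sum.cong) (simp_all add: mult_ac)
    finally show ?thesis by (simp only: R_def distrib_left sum_distrib_left mult_ac)
  qed
  have kpt: "Poly_Mapping.keys pt \<subseteq> {0..int n1} \<times> {0..int n2}" using keys_pt .
  have entry: "polyfun (\<lambda>w. pencil n1 n2 K z w $$ (i, j)) 1" "polyfun (\<lambda>w. pencil n1 n2 K w z $$ (i, j)) 1"
    if "i < ?N" "j < ?N" for i j z
    using polyfun_pencil_entry[OF that, of K z] by (auto intro: polyfun_mono)
  have pz: "polyfun (\<lambda>w. \<zeta> z w j) 1" "polyfun (\<lambda>w. \<zeta> w z j) 1" for z j
    unfolding \<zeta>_def by (cases "j < n1"; simp add: polyfun_const polyfun_id[unfolded One_nat_def])+
  have padj: "polyfun (\<lambda>w. adjl z w i) (?N - 1)" "polyfun (\<lambda>w. adjl w z i) (?N - 1)" if "i < ?N" for z i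
  proof -
    have "polyfun (\<lambda>w. adj_mat (pencil n1 n2 K z w) $$ (i, j)) (?N - 1)"
      "polyfun (\<lambda>w. adj_mat (pencil n1 n2 K w z) $$ (i, j)) (?N - 1)" if "j < ?N" for j
      by (rule adj_entry_polyfun[OF pencil_carrier _ \<open>i < ?N\<close> that]; rule entry; assumption)+
    then show "polyfun (\<lambda>w. adjl z w i) (?N - 1)" "polyfun (\<lambda>w. adjl w z i) (?N - 1)"
      unfolding adjl_def by (intro polyfun_sum polyfun_multc; simp)+
  qed
  have pD: "polyfun (\<lambda>w. D z w) n2" "polyfun (\<lambda>w. D w z) n1" for z
    unfolding D_def by (rule polyfun_det_pencil_right polyfun_det_pencil_left)+
  have pR: "polyfun (\<lambda>w. R z w) (1 + ?N)" "polyfun (\<lambda>w. R w z) (1 + ?N)" for z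
  proof -
    have "polyfun (\<lambda>w. b j * \<zeta> z w j * adjl z w j) (1 + ?N)" "polyfun (\<lambda>w. b j * \<zeta> w z j * adjl w z j) (1 + ?N)"
      if "j < ?N" for j
      using polyfun_mult[OF polyfun_cmult[OF pz(1)[of z j]] padj(1)[OF that, of z], of "b j"]
        polyfun_mult[OF polyfun_cmult[OF pz(2)[of z j]] padj(2)[OF that, of z], of "b j"]
      by (auto intro: polyfun_mono)
    then show "polyfun (\<lambda>w. R z w) (1 + ?N)" "polyfun (\<lambda>w. R w z) (1 + ?N)"
      unfolding R_def by (auto intro!: polyfun_add polyfun_sum polyfun_cmult
          polyfun_mono[OF pD(1)] polyfun_mono[OF pD(2)])
  qed
  \<comment> \<open>Up to a monomial, \<open>pt\<close> is the conjugate of p at the point reflected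
    in both circles. If one coordinate is unimodular, stability forces the other outside the closed
    disk, so the reflected point lies in the closed bidisk.\<close>
  have nocommon: "ev z w pt \<noteq> 0" if "ev z w p = 0" "cmod z = 1 \<and> w \<noteq> 0 \<or> cmod w = 1 \<and> z \<noteq> 0" for z w
  proof -
    have zw: "z \<noteq> 0" "w \<noteq> 0" using that(2) by auto
    have "cmod (inverse (cnj z)) \<le> 1 \<and> cmod (inverse (cnj w)) \<le> 1"
    proof (cases "cmod z = 1")
      case True
      then have "1 < cmod w" using stable[of z w] that(1) by force
      then show ?thesis using True by (simp add: norm_inverse inverse_le_1_iff)
    next
      case False
      then have w: "cmod w = 1" using that(2) by blast
      then have "1 < cmod z" using stable[of z w] that(1) by force
      then show ?thesis using w by (simp add: norm_inverse inverse_le_1_iff)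
    qed
    then have "ev (inverse (cnj z)) (inverse (cnj w)) p \<noteq> 0" using stable by blast
    then show ?thesis using zw by (simp add: rv_def ev_mult ev_star ev_single)
  qed
  have p00: "ev 0 0 p = 1"
  proof -
    have "ev 0 0 p = (\<Sum>a\<in>Poly_Mapping.keys p. if a = 0 then lookup p 0 else 0)"
      unfolding ev_def
      by (intro sum.cong) (auto simp: zero_prod_def prod_eq_iff power_int_0_left_if)
    then show ?thesis using p0 by (simp add: in_keys_iff)
  qed
  have z0: "ev z 0 p \<noteq> 0" "ev 0 z p \<noteq> 0" if "cmod z = 1" for z using stable that by auto
  have D00: "D 0 0 = 1"
  proof -
    have "pencil n1 n2 K 0 0 = 1\<^sub>m ?N" by (rule eq_matI) (auto simp: pencil_def)
    then show ?thesis by (simp add: D_def)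
  qed
  \<comment> \<open>\<open>t\<close> is the leading coefficient of p in w. Where |z| = 1 and
    \<open>t\<close> does not vanish, the slice of p has full degree \<open>n2\<close>, which
    matches the bound for \<open>D\<close>, so the slices are proportional. These z are infinitely
    many and both sides are polynomials in z, so the identity holds everywhere.\<close>
  have right: "D z w * ev z 0 p = D z 0 * ev z w p" for z w
  proof -
    define t where "t = (\<Sum>i\<le>n1. monom (lookup p (int i, int n2)) i)"
    have t0: "t \<noteq> 0"
    proof -
      obtain i where i: "lookup p (i, int n2) \<noteq> 0" using deg2 by blast
      then have "i \<in> {0..int n1}" using keys by (auto simp: in_keys_iff)
      then have "coeff t (nat i) = lookup p (i, int n2)" by (simp add: t_def coeff_sum nat_le_iff)
      then show ?thesis using i by auto
    qed
    have "D z w * ev z 0 p = D z 0 * ev z w p" if z: "cmod z = 1" "poly t z \<noteq> 0" for z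
    proof -
      define q where "q = (\<Sum>j\<le>n2. monom (\<Sum>i\<le>n1. lookup p (int i, int j) * z ^ i) j)"
      have q: "poly q w = ev z w p" for w
        unfolding q_def ev_double[OF keys]
        by (subst sum.swap) (simp add: poly_sum poly_monom sum_distrib_right mult.assoc)
      have "coeff q n2 = poly t z" by (simp add: q_def t_def coeff_sum poly_sum poly_monom)
      then have "coeff q n2 \<noteq> 0" using z by simp
      moreover have "degree q \<le> n2" by (rule degree_le) (auto simp: q_def coeff_sum)
      ultimately have dq: "degree q = n2" using le_degree le_antisym by blast
      have znz: "z \<noteq> 0" using z by auto
      have "D z w * poly q 0 = D z 0 * poly q w"
      proof (rule slice_proportional)
        show "polyfun (\<lambda>w. D z w) (degree q)" using pD dq by simp
        show "polyfun (\<lambda>w. ev z w pt) n2" by (rule polyfun_ev_right[OF kpt])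
        show "polyfun (\<lambda>w. R z w) (1 + ?N)" by (rule pR)
        show "ev z w pt * D z w = poly q w * R z w" if "w \<noteq> 0" for w using key[OF znz that] q by simp
        \<comment> \<open>At w = 0, where \<open>nocommon\<close> does not apply, p itself is
          nonzero by stability.\<close>
        show "ev z w pt \<noteq> 0" if "poly q w = 0" for w
          using nocommon[of z w] that z z0(1)[OF z(1)] by (cases "w = 0") (auto simp: q)
      qed
      then show ?thesis by (simp add: q)
    qed
    then have "{z. cmod z = 1 \<and> poly t z \<noteq> 0} \<subseteq> {z. D z w * ev z 0 p = D z 0 * ev z w p}" by blast
    then have "infinite {z. D z w * ev z 0 p = D z 0 * ev z w p}"
      using infinite_circle_minus_roots[OF t0] infinite_super by blast
    then show ?thesis
      using polyfun_eq[OF polyfun_mult[OF pD(2) polyfun_ev_left[OF keys]] polyfun_mult[OF pD(2) polyfun_ev_left[OF keys]]]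
      by blast
  qed
  have left: "D z w * ev 0 w p = D 0 w * ev z w p" for z w
  proof -
    define t where "t = (\<Sum>j\<le>n2. monom (lookup p (int n1, int j)) j)"
    have t0: "t \<noteq> 0"
    proof -
      obtain j where j: "lookup p (int n1, j) \<noteq> 0" using deg1 by blast
      then have "j \<in> {0..int n2}" using keys by (auto simp: in_keys_iff)
      then have "coeff t (nat j) = lookup p (int n1, j)" by (simp add: t_def coeff_sum nat_le_iff)
      then show ?thesis using j by auto
    qed
    have "D z w * ev 0 w p = D 0 w * ev z w p" if w: "cmod w = 1" "poly t w \<noteq> 0" for w
    proof -
      define q where "q = (\<Sum>i\<le>n1. monom (\<Sum>j\<le>n2. lookup p (int i, int j) * w ^ j) i)"
      have q: "poly q z = ev z w p" for z
        unfolding q_def ev_double[OF keys]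
        by (simp add: poly_sum poly_monom sum_distrib_left mult_ac)
      have "coeff q n1 = poly t w" by (simp add: q_def t_def coeff_sum poly_sum poly_monom)
      then have "coeff q n1 \<noteq> 0" using w by simp
      moreover have "degree q \<le> n1" by (rule degree_le) (auto simp: q_def coeff_sum)
      ultimately have dq: "degree q = n1" using le_degree le_antisym by blast
      have wnz: "w \<noteq> 0" using w by auto
      have "D z w * poly q 0 = D 0 w * poly q z"
      proof (rule slice_proportional)
        show "polyfun (\<lambda>z. D z w) (degree q)" using pD dq by simp
        show "polyfun (\<lambda>z. ev z w pt) n1" by (rule polyfun_ev_left[OF kpt])
        show "polyfun (\<lambda>z. R z w) (1 + ?N)" by (rule pR)
        show "ev z w pt * D z w = poly q z * R z w" if "z \<noteq> 0" for z using key[OF that wnz] q by simp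
        show "ev z w pt \<noteq> 0" if "poly q z = 0" for z
          using nocommon[of z w] that w z0(2)[OF w(1)] by (cases "z = 0") (auto simp: q)
      qed
      then show ?thesis by (simp add: q)
    qed
    then have "{w. cmod w = 1 \<and> poly t w \<noteq> 0} \<subseteq> {w. D z w * ev 0 w p = D 0 w * ev z w p}" by blast
    then have "infinite {w. D z w * ev 0 w p = D 0 w * ev z w p}"
      using infinite_circle_minus_roots[OF t0] infinite_super by blast
    then show ?thesis
      using polyfun_eq[OF polyfun_mult[OF pD(1) polyfun_ev_right[OF keys]] polyfun_mult[OF pD(1) polyfun_ev_right[OF keys]]]
      by blast
  qed
  \<comment> \<open>The proportionality factor of the z-slices is fixed at the origin, where both
    sides are 1. With this value, \<open>right\<close> gives equality wherever p(z,0) is nonzero, in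
    particular for |z| = 1.\<close>
  have axis: "D z 0 = ev z 0 p" for z using left[of z 0] by (simp add: p00 D00)
  have "D z w = ev z w p" for z w
  proof -
    have "{z. cmod z = 1} \<subseteq> {z. D z w = ev z w p}"
      using right[of _ w] z0 axis by auto
    moreover have "infinite {z. cmod z = 1}" using infinite_circle_minus_roots[of 1] by simp
    ultimately have "infinite {z. D z w = ev z w p}" using infinite_super by blast
    then show ?thesis using polyfun_eq[OF pD(2) polyfun_ev_left[OF keys]] by blast
  qed
  then show ?thesis using that[of K] contr by (simp add: D_def)
qed

section \<open>Matrices and the stability radius\<close>

lemma euclidean_norm_sq: "(euclidean_norm v)\<^sup>2 = (\<Sum>i<dim_vec v. (cmod (v $ i))\<^sup>2)"
  by (simp add: euclidean_norm_def L2_set_def sum_nonneg)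

lemma euclidean_norm_nonneg [simp]: "0 \<le> euclidean_norm v"
  by (simp add: euclidean_norm_def L2_set_nonneg)

lemma euclidean_norm_smult: "euclidean_norm (c \<cdot>\<^sub>v v) = cmod c * euclidean_norm v"
  by (rule power2_eq_imp_eq)
     (simp_all add: power_mult_distrib euclidean_norm_sq norm_mult sum_distrib_left)

lemma euclidean_norm_pos:
  assumes "v \<in> carrier_vec n" "v \<noteq> 0\<^sub>v n"
  shows "euclidean_norm v > 0"
proof (rule ccontr)
  assume "\<not> euclidean_norm v > 0"
  then have "(euclidean_norm v)\<^sup>2 = 0" using euclidean_norm_nonneg[of v] by simp
  then have "\<forall>i\<in>{..<dim_vec v}. (cmod (v $ i))\<^sup>2 = 0"
    unfolding euclidean_norm_sq by (subst (asm) sum_nonneg_eq_0_iff) auto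
  then show False using assms by (auto intro: eq_vecI)
qed

text \<open>The bound \<open>c\<close> makes the set under the supremum bounded above, so that the
  supremum dominates its members; the second claim then follows by normalising
  \<open>v\<close>.\<close>

lemma mat_op_norm_le:
  assumes A: "A \<in> carrier_mat n n" and "\<And>v. v \<in> carrier_vec n \<Longrightarrow> euclidean_norm (A *\<^sub>v v) \<le> c * euclidean_norm v"
    and "0 \<le> c"
  shows "mat_op_norm A \<le> c"
    and "v \<in> carrier_vec n \<Longrightarrow> euclidean_norm (A *\<^sub>v v) \<le> mat_op_norm A * euclidean_norm v"
proof -
  let ?B = "{v \<in> carrier_vec (dim_col A). euclidean_norm v \<le> 1}"
  have dim: "dim_col A = n" using A by auto
  have le: "euclidean_norm (A *\<^sub>v v) \<le> c" if "v \<in> ?B" for v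
    using assms(2)[of v] that \<open>0 \<le> c\<close> mult_left_le[of "euclidean_norm v" c] by (auto simp: dim)
  have "euclidean_norm (0\<^sub>v n) = 0" by (simp add: euclidean_norm_def L2_set_def)
  then have ne: "?B \<noteq> {}" by (intro ex_in_conv[THEN iffD1] exI[of _ "0\<^sub>v n"]) (simp add: dim)
  show "mat_op_norm A \<le> c"
    unfolding mat_op_norm_def using ne le by (intro cSUP_least) auto
  have bdd: "bdd_above ((\<lambda>v. euclidean_norm (A *\<^sub>v v)) ` ?B)" using le by (intro bdd_aboveI2) auto
  assume v: "v \<in> carrier_vec n"
  show "euclidean_norm (A *\<^sub>v v) \<le> mat_op_norm A * euclidean_norm v"
  proof (cases "v = 0\<^sub>v n")
    case True
    then have "A *\<^sub>v v = 0\<^sub>v n" using A by (intro eq_vecI) auto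
    then show ?thesis using True \<open>euclidean_norm (0\<^sub>v n) = 0\<close> by simp
  next
    case False
    then have pos: "euclidean_norm v > 0" using euclidean_norm_pos v by blast
    define u where "u = complex_of_real (1 / euclidean_norm v) \<cdot>\<^sub>v v"
    have "euclidean_norm u = 1" using pos by (simp add: u_def euclidean_norm_smult norm_divide)
    then have "u \<in> ?B" using v by (simp add: u_def dim)
    then have "euclidean_norm (A *\<^sub>v u) \<le> mat_op_norm A"
      unfolding mat_op_norm_def using bdd by (intro cSUP_upper)
    moreover have "A *\<^sub>v u = complex_of_real (1 / euclidean_norm v) \<cdot>\<^sub>v (A *\<^sub>v v)"
      unfolding u_def using A v by (rule mult_mat_vec)
    ultimately show ?thesis using pos by (simp add: euclidean_norm_smult norm_divide field_simps)
  qed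
qed

lemma Z_mat_eq:
  "Z_mat n1 n2 z w = mat (n1 + n2) (n1 + n2) (\<lambda>(i, j). if i = j then (if j < n1 then z else w) else 0)"
  by (rule eq_matI) (auto simp: Z_mat_def Let_def)

lemma mult_Z_mat:
  assumes "K \<in> carrier_mat (n1 + n2) (n1 + n2)"
  shows "1\<^sub>m (n1 + n2) - K * Z_mat n1 n2 z w = pencil n1 n2 (\<lambda>i j. K $$ (i, j)) z w"
proof (rule eq_matI)
  fix i j assume "i < dim_row (pencil n1 n2 (\<lambda>i j. K $$ (i, j)) z w)"
    "j < dim_col (pencil n1 n2 (\<lambda>i j. K $$ (i, j)) z w)"
  then have ij: "i < n1 + n2" "j < n1 + n2" by (auto simp: pencil_def)
  define c where "c = (if j < n1 then z else w)"
  have "(K * Z_mat n1 n2 z w) $$ (i, j) = (\<Sum>k = 0..<n1 + n2. K $$ (i, k) * Z_mat n1 n2 z w $$ (k, j))"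
    using assms ij by (simp add: Z_mat_eq scalar_prod_def)
  also have "\<dots> = (\<Sum>k = 0..<n1 + n2. if k = j then K $$ (i, j) * c else 0)"
    using ij by (intro sum.cong) (auto simp: Z_mat_eq c_def)
  also have "\<dots> = K $$ (i, j) * (if j < n1 then z else w)" using ij by (simp add: c_def)
  finally show "(1\<^sub>m (n1 + n2) - K * Z_mat n1 n2 z w) $$ (i, j) = pencil n1 n2 (\<lambda>i j. K $$ (i, j)) z w $$ (i, j)"
    using ij assms by (simp add: pencil_def Z_mat_eq)
qed (use assms in \<open>auto simp: pencil_def Z_mat_eq\<close>)

text \<open>Bolzano-Weierstrass, applied to one index at a time and passing to a further
  subsequence.\<close>

lemma finite_family_subsequence:
  fixes f :: "nat \<Rightarrow> 'a \<Rightarrow> complex"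
  assumes "finite A" "\<And>a n. a \<in> A \<Longrightarrow> cmod (f n a) \<le> B"
  shows "\<exists>\<phi> l. strict_mono \<phi> \<and> (\<forall>a\<in>A. (\<lambda>n. f (\<phi> n) a) \<longlonglongrightarrow> l a)"
  using assms
proof (induction A rule: finite_induct)
  case empty
  then show ?case by (intro exI[of _ id]) (auto simp: strict_mono_def)
next
  case (insert a A)
  then obtain \<phi> l where \<phi>: "strict_mono \<phi>" "\<forall>b\<in>A. (\<lambda>n. f (\<phi> n) b) \<longlonglongrightarrow> l b" by auto
  have "bounded (range (\<lambda>n. f (\<phi> n) a))" using insert(4) by (intro boundedI[of _ B]) auto
  from bounded_imp_convergent_subsequence[OF this] obtain m \<psi>
    where \<psi>: "strict_mono \<psi>" "((\<lambda>n. f (\<phi> n) a) \<circ> \<psi>) \<longlonglongrightarrow> m" by blast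
  have "(\<lambda>n. f (\<phi> (\<psi> n)) b) \<longlonglongrightarrow> (l(a := m)) b" if "b \<in> insert a A" for b
    using \<psi>(2) LIMSEQ_subseq_LIMSEQ[OF _ \<psi>(1), of "\<lambda>n. f (\<phi> n) b" "l b"] \<phi>(2) that insert(2)
    by (cases "b = a") (auto simp: o_def)
  moreover have "strict_mono (\<lambda>n. \<phi> (\<psi> n))" using \<phi>(1) \<psi>(1) by (simp add: strict_mono_def)
  ultimately show ?case by (intro exI[of _ "\<lambda>n. \<phi> (\<psi> n)"] exI[of _ "l(a := m)"]) auto
qed

lemma tendsto_det_pencil:
  assumes "\<And>i j. i < n1 + n2 \<Longrightarrow> j < n1 + n2 \<Longrightarrow> (\<lambda>n. K n i j) \<longlonglongrightarrow> K' i j"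
  shows "(\<lambda>n. Determinant.det (pencil n1 n2 (K n) z w)) \<longlonglongrightarrow> Determinant.det (pencil n1 n2 K' z w)"
  unfolding det_col[OF pencil_carrier]
proof (intro tendsto_sum tendsto_mult tendsto_const tendsto_prod)
  fix \<pi> j assume "\<pi> \<in> {\<pi>. \<pi> permutes {0..<n1 + n2}}" "j \<in> {..<n1 + n2}"
  then have "\<pi> j < n1 + n2" "j < n1 + n2"
    using permutes_in_image[of \<pi> "{0..<n1 + n2}" j] by auto
  then show "(\<lambda>n. pencil n1 n2 (K n) z w $$ (\<pi> j, j)) \<longlonglongrightarrow> pencil n1 n2 K' z w $$ (\<pi> j, j)"
    by (auto simp: pencil_def intro!: tendsto_intros assms)
qed

section \<open>Bidegree and stability radius\<close>

lemma coeff_bidegree_0: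
  assumes bideg: "bidegree p = (n1, n2)" and "n1 < i \<or> n2 < j"
  shows "coeff (coeff p j) i = 0"
proof (cases "j \<le> degree p")
  case True
  then have "n1 < i" using assms by (auto simp: bidegree_def)
  moreover have "degree (coeff p j) \<le> n1"
    using bideg True by (auto simp: bidegree_def intro!: Max_ge)
  ultimately show ?thesis by (intro coeff_eq_0) auto
qed (simp add: coeff_eq_0)

lemma bipoly_bidegree:
  assumes bideg: "bidegree p = (n1, n2)"
  shows "bipoly p z w = (\<Sum>i\<le>n1. \<Sum>j\<le>n2. coeff (coeff p j) i * (z ^ i * w ^ j))"
proof -
  have n2: "n2 = degree p" using bideg by (simp add: bidegree_def)
  have "bipoly p z w = (\<Sum>j\<le>n2. \<Sum>i\<le>n1. coeff (coeff p j) i * z ^ i * w ^ j)"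
    unfolding bipoly_altdef n2
  proof (rule sum.cong[OF refl], rule sum.mono_neutral_left)
    fix j assume "j \<in> {..degree p}"
    then have "degree (coeff p j) \<le> n1"
      using bideg by (auto simp: bidegree_def intro!: Max_ge)
    then show "{..degree (coeff p j)} \<subseteq> {..n1}" by auto
  qed (auto simp: coeff_eq_0)
  then show ?thesis by (subst sum.swap) (simp add: mult.assoc)
qed

definition stable_upto :: "complex poly poly \<Rightarrow> real \<Rightarrow> bool" where
  "stable_upto p r \<longleftrightarrow> r > 0 \<and> (\<forall>z w. cmod z < r \<longrightarrow> cmod w < r \<longrightarrow> bipoly p z w \<noteq> 0)"

lemma stability_radius_eq: "stability_radius p = (GREATEST r. stable_upto p r)"
proof -
  have "(r > 0 \<and> (\<forall>(z1, z2) \<in> (\<lambda>z. r *\<^sub>R z) ` unit_bidisk. bipoly p z1 z2 \<noteq> 0)) \<longleftrightarrow> stable_upto p r" for r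
  proof (cases "r > 0")
    case True
    have "(\<lambda>z. r *\<^sub>R z) ` unit_bidisk = {(z, w). cmod z < r \<and> cmod w < r}"
    proof (intro equalityI subsetI)
      fix x assume "x \<in> {(z, w). cmod z < r \<and> cmod w < r}"
      then have "(1 / r) *\<^sub>R x \<in> unit_bidisk" "x = r *\<^sub>R ((1 / r) *\<^sub>R x)"
        using True by (auto simp: unit_bidisk_def)
      then show "x \<in> (\<lambda>z. r *\<^sub>R z) ` unit_bidisk" by blast
    qed (use True in \<open>auto simp: unit_bidisk_def\<close>)
    then show ?thesis using True by (auto simp: stable_upto_def)
  qed (simp add: stable_upto_def)
  then show ?thesis unfolding stability_radius_def by simp
qed

lemma continuous_bipoly: "continuous_on UNIV (\<lambda>x. bipoly p (fst x) (snd x))"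
  unfolding bipoly_altdef by (intro continuous_intros)

text \<open>Restricted to a complex line through the origin, a zero-free polynomial is constant by
  the fundamental theorem of algebra, hence equal to 1. So p is 1 at every point and therefore the
  constant polynomial 1.\<close>

lemma bipoly_has_zero:
  assumes nonconst: "\<not> (\<exists>c. p = [:[:c:]:])" and at_origin: "bipoly p 0 0 = 1"
  shows "\<exists>z w. bipoly p z w = 0"
proof (rule ccontr)
  assume nz: "\<not> (\<exists>z w. bipoly p z w = 0)"
  have one: "bipoly p z w = 1" for z w
  proof -
    define q where "q = (\<Sum>j\<le>degree p. \<Sum>i\<le>degree (coeff p j). monom (coeff (coeff p j) i * z ^ i * w ^ j) (i + j))"
    have q: "poly q t = bipoly p (t * z) (t * w)" for t
      unfolding q_def bipoly_altdef
      by (simp add: poly_sum poly_monom power_add power_mult_distrib mult_ac)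
    have "constant (poly q)"
      using fundamental_theorem_of_algebra[of q] nz q by auto
    then have "poly q 1 = poly q 0" by (simp add: constant_def)
    then show ?thesis using at_origin by (simp add: q)
  qed
  have slice: "poly p [:w:] = 1" for w
  proof -
    have "poly (poly p [:w:]) z = poly 1 z" for z using one[of z w] by (simp add: bipoly_def)
    then show ?thesis by (metis poly_eq_poly_eq_iff ext)
  qed
  have "range (\<lambda>w. [:w:]) \<subseteq> {x. poly (p - 1) x = 0}" using slice by auto
  moreover have "infinite (range (\<lambda>w :: complex. [:w:]))"
    using finite_imageD[of "\<lambda>w :: complex. [:w:]" UNIV] infinite_UNIV_char_0[where ?'a = complex]
    by (auto simp: inj_on_def)
  ultimately have "infinite {x. poly (p - 1) x = 0}" using infinite_super by blast
  then have "p - 1 = 0" using poly_roots_finite by blast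
  then have "p = [:[:1:]:]" by (simp add: one_pCons)
  then show False using nonconst by blast
qed

text \<open>A zero of p bounds the admissible radii and continuity at the origin provides one. The
  supremum is itself admissible because the open bidisks are nested: every point of the largest one
  lies in a smaller admissible one.\<close>

lemma stability_radius_greatest:
  assumes nonconst: "\<not> (\<exists>c. p = [:[:c:]:])" and at_origin: "bipoly p 0 0 = 1"
  shows "stable_upto p (stability_radius p)" "stable_upto p r \<Longrightarrow> r \<le> stability_radius p"
proof -
  obtain z0 w0 where zero: "bipoly p z0 w0 = 0" using bipoly_has_zero[OF assms] by blast
  have ub: "r \<le> max (cmod z0) (cmod w0)" if "stable_upto p r" for r
    using that zero unfolding stable_upto_def by (meson not_le max_less_iff_conj)
  have "isCont (\<lambda>x. bipoly p (fst x) (snd x)) (0, 0)"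
    using continuous_bipoly by (simp add: continuous_on_eq_continuous_at)
  then have "((\<lambda>x. bipoly p (fst x) (snd x)) \<longlongrightarrow> bipoly p 0 0) (nhds (0, 0))"
    using tendsto_at_iff_tendsto_nhds[of "\<lambda>x. bipoly p (fst x) (snd x)" "(0, 0)"]
    by (simp add: isCont_def)
  then have "\<forall>\<^sub>F x in nhds (0, 0). bipoly p (fst x) (snd x) \<noteq> 0"
    by (rule tendsto_imp_eventually_ne) (simp add: at_origin)
  then obtain e where e: "e > 0" "\<And>x. dist x (0, 0) < e \<Longrightarrow> bipoly p (fst x) (snd x) \<noteq> 0"
    unfolding eventually_nhds_metric by blast
  \<comment> \<open>Half of \<open>e\<close>, since the distance to the origin in the product is at
    most |z| + |w|.\<close>
  have e2: "stable_upto p (e / 2)"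
    unfolding stable_upto_def
  proof (intro conjI allI impI)
    fix z w :: complex assume zw: "cmod z < e / 2" "cmod w < e / 2"
    have "dist (z, w) (0, 0) \<le> cmod z + cmod w"
      by (simp add: dist_Pair_Pair) (metis sqrt_sum_squares_le_sum norm_ge_zero)
    then show "bipoly p z w \<noteq> 0" using e(2)[of "(z, w)"] zw by simp
  qed (use e in simp)
  define s where "s = Sup {r. stable_upto p r}"
  have bdd: "bdd_above {r. stable_upto p r}" using ub by (intro bdd_aboveI) auto
  have le_s: "r \<le> s" if "stable_upto p r" for r
    unfolding s_def using that bdd by (intro cSup_upper) auto
  have "stable_upto p s"
    unfolding stable_upto_def
  proof (intro conjI allI impI)
    show "s > 0" using le_s[OF e2] e by simp
    fix z w :: complex assume "cmod z < s" "cmod w < s"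
    then have "max (cmod z) (cmod w) < Sup {r. stable_upto p r}" by (simp add: s_def)
    then obtain r where "stable_upto p r" "max (cmod z) (cmod w) < r"
      using less_cSup_iff[OF _ bdd] e2 by blast
    then show "bipoly p z w \<noteq> 0" by (simp add: stable_upto_def)
  qed
  moreover from this have "stability_radius p = s"
    unfolding stability_radius_eq using le_s by (intro Greatest_equality)
  ultimately show "stable_upto p (stability_radius p)" "stable_upto p r \<Longrightarrow> r \<le> stability_radius p"
    using le_s by auto
qed

section \<open>Dilation and passage to the limit\<close>

lemma dilated_representation:
  fixes p :: "complex poly poly" and r :: real
  assumes at_origin: "bipoly p 0 0 = 1" and bideg: "bidegree p = (n1, n2)"
    and st: "stable_upto p s" and r: "0 < r" "r < s"
  obtains K :: "nat \<Rightarrow> nat \<Rightarrow> complex" where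
    "\<And>v. (\<Sum>i<n1 + n2. (cmod (\<Sum>j<n1 + n2. K i j * v j))\<^sup>2) \<le> (\<Sum>j<n1 + n2. (cmod (v j))\<^sup>2)"
    "\<And>z w. bipoly p (of_real r * z) (of_real r * w) = Determinant.det (pencil n1 n2 K z w)"
proof -
  define x where "x = (\<Sum>i\<le>n1. \<Sum>j\<le>n2. single (int i, int j) (coeff (coeff p j) i * of_real r ^ (i + j)))"
  have lx: "lookup x (int i, int j) = coeff (coeff p j) i * of_real r ^ (i + j)" if "i \<le> n1" "j \<le> n2" for i j
  proof -
    have "lookup x (int i, int j) = (\<Sum>k\<le>n1. \<Sum>l\<le>n2.
        if k = i then (if l = j then coeff (coeff p j) i * of_real r ^ (i + j) else 0) else 0)"
      unfolding x_def lookup_sum by (intro sum.cong) (auto simp: lookup_single when_def)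
    also have "\<dots> = (\<Sum>k\<le>n1. if k = i then coeff (coeff p j) i * of_real r ^ (i + j) else 0)"
      using that by (intro sum.cong) auto
    finally show ?thesis using that by simp
  qed
  have keys: "keys x \<subseteq> {0..int n1} \<times> {0..int n2}"
    unfolding x_def by (intro keys_sum_subset) auto
  have ev: "ev z w x = bipoly p (of_real r * z) (of_real r * w)" for z w
    unfolding ev_double[OF keys] bipoly_bidegree[OF bideg]
    by (intro sum.cong) (auto simp: lx power_add power_mult_distrib)
  \<comment> \<open>The maximal degree \<open>n1\<close> may be attained at a zero coefficient
    polynomial, but then n1 = 0 and the constant term 1 serves as witness later.\<close>
  obtain j where j: "j \<le> n2" "coeff (coeff p j) n1 \<noteq> 0 \<or> n1 = 0"
  proof -
    have "n1 \<in> (\<lambda>j. degree (coeff p j)) ` {..degree p}"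
      using bideg Max_in[of "(\<lambda>j. degree (coeff p j)) ` {..degree p}"] by (auto simp: bidegree_def)
    then obtain j where "j \<le> degree p" "n1 = degree (coeff p j)" by auto
    then have "j \<le> n2" "coeff (coeff p j) n1 \<noteq> 0 \<or> n1 = 0" using bideg by (auto simp: bidegree_def)
    then show ?thesis by (rule that)
  qed
  have c00: "coeff (coeff p 0) 0 = 1" using at_origin by (simp add: bipoly_def poly_0_coeff_0)
  show ?thesis
  proof (rule stable_representation[OF keys])
    \<comment> \<open>The strict inequality r < s turns zero-freeness on the open bidisk of radius s
      into zero-freeness of the dilated polynomial on the closed unit bidisk.\<close>
    show "ev z w x \<noteq> 0" if zw: "cmod z \<le> 1" "cmod w \<le> 1" for z w
    proof -
      have "cmod (of_real r * u) < s" if "cmod u \<le> 1" for u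
      proof -
        have "cmod (of_real r * u) = r * cmod u" using r by (simp add: norm_mult)
        also have "\<dots> \<le> r" using r that by (intro mult_left_le) auto
        also have "\<dots> < s" by (rule r)
        finally show ?thesis .
      qed
      then show ?thesis using st zw unfolding ev stable_upto_def by blast
    qed
    show "lookup x 0 = 1" using lx[of 0 0] c00 by (simp add: zero_prod_def)
    have "\<exists>j\<le>n2. coeff (coeff p j) n1 \<noteq> 0" using j c00 by (cases "n1 = 0") auto
    then show "\<exists>j. lookup x (int n1, j) \<noteq> 0" using lx r by (metis le_refl mult_eq_0_iff of_real_eq_0_iff order_less_irrefl power_eq_0_iff)
    have "p \<noteq> 0" using c00 by auto
    then have "coeff p n2 \<noteq> 0" using bideg by (auto simp: bidegree_def)
    then obtain i where i: "coeff (coeff p n2) i \<noteq> 0" by (metis leading_coeff_0_iff)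
    then have "i \<le> n1" using coeff_bidegree_0[OF bideg, of i n2] by (meson not_le)
    then show "\<exists>i. lookup x (i, int n2) \<noteq> 0" using lx[of i n2] i r by (intro exI[of _ "int i"]) auto
    fix K :: "nat \<Rightarrow> nat \<Rightarrow> complex"
    assume "\<And>v. (\<Sum>i<n1 + n2. (cmod (\<Sum>j<n1 + n2. K i j * v j))\<^sup>2) \<le> (\<Sum>j<n1 + n2. (cmod (v j))\<^sup>2)"
      "\<And>z w. ev z w x = Determinant.det (pencil n1 n2 K z w)"
    then show thesis by (intro that[of K]) (auto simp: ev)
  qed
qed

lemma contraction_entry_le:
  fixes K :: "nat \<Rightarrow> nat \<Rightarrow> complex"
  assumes "\<And>v. (\<Sum>i<n. (cmod (\<Sum>j<n. K i j * v j))\<^sup>2) \<le> (\<Sum>j<n. (cmod (v j))\<^sup>2)" "i < n" "j < n"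
  shows "cmod (K i j) \<le> 1"
proof -
  let ?v = "\<lambda>l. if l = j then 1 else 0 :: complex"
  have e: "(\<Sum>l<n. K k l * ?v l) = K k j" for k
    using assms(3) by (simp add: if_distrib cong: if_cong)
  have "(cmod (K i j))\<^sup>2 \<le> (\<Sum>k<n. (cmod (K k j))\<^sup>2)"
    using assms(2) by (intro member_le_sum) auto
  also have "\<dots> \<le> (\<Sum>l<n. (cmod (?v l))\<^sup>2)" using assms(1)[of ?v] by (simp only: e)
  also have "\<dots> = (\<Sum>l<n. if l = j then 1 else 0)" by (intro sum.cong) auto
  also have "\<dots> = 1" using assms(3) by simp
  finally show ?thesis using power2_le_imp_le[of "cmod (K i j)" 1] by simp
qed

text \<open>Contractions have entries of modulus at most 1, so representing matrices for radii
  increasing to s have a convergent subsequence; the contraction inequality and the determinant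
  identity are closed conditions.\<close>

lemma limit_representation:
  fixes p :: "complex poly poly"
  assumes at_origin: "bipoly p 0 0 = 1" and bideg: "bidegree p = (n1, n2)"
    and st: "stable_upto p s"
  obtains K :: "nat \<Rightarrow> nat \<Rightarrow> complex" where
    "\<And>v. (\<Sum>i<n1 + n2. (cmod (\<Sum>j<n1 + n2. K i j * v j))\<^sup>2) \<le> (\<Sum>j<n1 + n2. (cmod (v j))\<^sup>2)"
    "\<And>z w. bipoly p (of_real s * z) (of_real s * w) = Determinant.det (pencil n1 n2 K z w)"
proof -
  let ?N = "n1 + n2"
  \<comment> \<open>The double successor makes already \<open>r 0\<close> = s/2 positive.\<close>
  define r where "r k = s * (1 - inverse (real (Suc (Suc k))))" for k
  have s: "s > 0" using st by (simp add: stable_upto_def)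
  have r: "0 < r k" "r k < s" for k
  proof -
    have "0 < inverse (real (Suc (Suc k)))" "inverse (real (Suc (Suc k))) < 1"
      by (simp_all add: inverse_less_1_iff)
    then show "0 < r k" "r k < s" using s by (simp_all add: r_def)
  qed
  define Q where "Q k K \<longleftrightarrow> (\<forall>v. (\<Sum>i<?N. (cmod (\<Sum>j<?N. K i j * v j))\<^sup>2) \<le> (\<Sum>j<?N. (cmod (v j))\<^sup>2)) \<and>
      (\<forall>z w. bipoly p (of_real (r k) * z) (of_real (r k) * w) = Determinant.det (pencil n1 n2 K z w))" for k K
  have "\<exists>K. Q k K" for k
    unfolding Q_def by (rule dilated_representation[OF at_origin bideg st r(1)[of k] r(2)[of k]]) blast
  then obtain K where "\<And>k. Q k (K k)" by metis
  then have contr: "\<And>k v. (\<Sum>i<?N. (cmod (\<Sum>j<?N. K k i j * v j))\<^sup>2) \<le> (\<Sum>j<?N. (cmod (v j))\<^sup>2)"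
    and rep: "\<And>k z w. bipoly p (of_real (r k) * z) (of_real (r k) * w) = Determinant.det (pencil n1 n2 (K k) z w)"
    unfolding Q_def by blast+
  have "\<exists>\<phi> l. strict_mono \<phi> \<and> (\<forall>a\<in>{..<?N} \<times> {..<?N}. (\<lambda>n. K (\<phi> n) (fst a) (snd a)) \<longlonglongrightarrow> l a)"
    by (rule finite_family_subsequence[of _ "\<lambda>n a. K n (fst a) (snd a)" 1])
       (auto intro: contraction_entry_le[OF contr])
  then obtain \<phi> l where \<phi>: "strict_mono \<phi>"
    and lim: "\<And>i j. i < ?N \<Longrightarrow> j < ?N \<Longrightarrow> (\<lambda>n. K (\<phi> n) i j) \<longlonglongrightarrow> l (i, j)" by fastforce
  have r_lim: "(\<lambda>n. r (\<phi> n)) \<longlonglongrightarrow> s"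
  proof -
    have "(\<lambda>k. s * (1 - inverse (real (Suc (Suc k))))) \<longlonglongrightarrow> s * (1 - 0)"
      by (intro tendsto_intros LIMSEQ_Suc[OF LIMSEQ_inverse_real_of_nat])
    then have "r \<longlonglongrightarrow> s" by (simp add: r_def[abs_def])
    from LIMSEQ_subseq_LIMSEQ[OF this \<phi>] show ?thesis by (simp add: o_def)
  qed
  show ?thesis
  proof (rule that[of "\<lambda>i j. l (i, j)"])
    fix v :: "nat \<Rightarrow> complex"
    have "(\<lambda>n. \<Sum>i<?N. (cmod (\<Sum>j<?N. K (\<phi> n) i j * v j))\<^sup>2) \<longlonglongrightarrow> (\<Sum>i<?N. (cmod (\<Sum>j<?N. l (i, j) * v j))\<^sup>2)"
      by (intro tendsto_intros lim) auto
    then show "(\<Sum>i<?N. (cmod (\<Sum>j<?N. l (i, j) * v j))\<^sup>2) \<le> (\<Sum>j<?N. (cmod (v j))\<^sup>2)"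
      by (rule LIMSEQ_le_const2) (use contr in auto)
  next
    fix z w
    have "(\<lambda>n. bipoly p (of_real (r (\<phi> n)) * z) (of_real (r (\<phi> n)) * w)) \<longlonglongrightarrow> bipoly p (of_real s * z) (of_real s * w)"
      unfolding bipoly_altdef by (intro tendsto_intros r_lim)
    moreover have "(\<lambda>n. Determinant.det (pencil n1 n2 (K (\<phi> n)) z w)) \<longlonglongrightarrow> Determinant.det (pencil n1 n2 (\<lambda>i j. l (i, j)) z w)"
      by (intro tendsto_det_pencil lim)
    ultimately show "bipoly p (of_real s * z) (of_real s * w) = Determinant.det (pencil n1 n2 (\<lambda>i j. l (i, j)) z w)"
      unfolding rep by (rule LIMSEQ_unique)
  qed
qed

theorem theorem2p1:
  fixes p :: "complex poly poly" and n1 n2 :: nat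
  assumes nonconst: "\<not> (\<exists>c. p = [:[:c:]:])"
    and at_origin: "bipoly p 0 0 = 1"
    and bideg: "bidegree p = (n1, n2)"
  shows "\<exists>K \<in> carrier_mat (n1 + n2) (n1 + n2).
           (\<forall>z1 z2. bipoly p z1 z2 = Determinant.det (1\<^sub>m (n1 + n2) - K * Z_mat n1 n2 z1 z2)) \<and>
           mat_op_norm K = inverse (stability_radius p)"
proof -
  let ?N = "n1 + n2"
  define s where "s = stability_radius p"
  have st: "stable_upto p s" and greatest: "\<And>r. stable_upto p r \<Longrightarrow> r \<le> s"
    using stability_radius_greatest[OF nonconst at_origin] by (auto simp: s_def)
  have s: "s > 0" using st by (simp add: stable_upto_def)
  obtain K0 :: "nat \<Rightarrow> nat \<Rightarrow> complex" where
    contr: "\<And>v. (\<Sum>i<?N. (cmod (\<Sum>j<?N. K0 i j * v j))\<^sup>2) \<le> (\<Sum>j<?N. (cmod (v j))\<^sup>2)" and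
    rep: "\<And>z w. bipoly p (of_real s * z) (of_real s * w) = Determinant.det (pencil n1 n2 K0 z w)"
    by (rule limit_representation[OF at_origin bideg st]) blast
  \<comment> \<open>\<open>K0\<close> represents p(s z, s w); dividing by s undoes the dilation and
    turns the contraction bound 1 into 1/s.\<close>
  define K where "K = mat ?N ?N (\<lambda>(i, j). K0 i j / of_real s)"
  have K: "K \<in> carrier_mat ?N ?N" by (simp add: K_def)
  have repK: "bipoly p z w = Determinant.det (1\<^sub>m ?N - K * Z_mat n1 n2 z w)" for z w
  proof -
    have "pencil n1 n2 (\<lambda>i j. K $$ (i, j)) z w = pencil n1 n2 K0 (z / of_real s) (w / of_real s)"
      by (rule eq_matI) (auto simp: pencil_def K_def)
    then show ?thesis using rep[of "z / of_real s" "w / of_real s"] s by (simp add: mult_Z_mat[OF K])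
  qed
  have bound: "euclidean_norm (K *\<^sub>v v) \<le> inverse s * euclidean_norm v" if v: "v \<in> carrier_vec ?N" for v
  proof (rule power2_le_imp_le)
    have "(euclidean_norm (K *\<^sub>v v))\<^sup>2 = (\<Sum>i<?N. (cmod ((\<Sum>j<?N. K0 i j * (v $ j)) / of_real s))\<^sup>2)"
      using v unfolding euclidean_norm_sq
      by (intro sum.cong)
         (auto simp: K_def scalar_prod_def lessThan_atLeast0 sum_divide_distrib)
    also have "\<dots> = (\<Sum>i<?N. (cmod (\<Sum>j<?N. K0 i j * (v $ j)))\<^sup>2) / s\<^sup>2"
      unfolding norm_divide power_divide sum_divide_distrib[symmetric] using s by simp
    also have "\<dots> \<le> (\<Sum>j<?N. (cmod (v $ j))\<^sup>2) / s\<^sup>2"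
      by (intro divide_right_mono contr) simp
    also have "\<dots> = (inverse s * euclidean_norm v)\<^sup>2"
      using v by (simp add: power_mult_distrib euclidean_norm_sq field_simps)
    finally show "(euclidean_norm (K *\<^sub>v v))\<^sup>2 \<le> (inverse s * euclidean_norm v)\<^sup>2" .
  qed (use s in simp)
  have le: "mat_op_norm K \<le> inverse s" using mat_op_norm_le(1)[OF K bound] s by simp
  have op: "euclidean_norm (K *\<^sub>v v) \<le> mat_op_norm K * euclidean_norm v" if "v \<in> carrier_vec ?N" for v
    using mat_op_norm_le(2)[OF K bound _ that] s by simp
  have "\<not> mat_op_norm K < inverse s"
  proof
    assume less: "mat_op_norm K < inverse s"
    \<comment> \<open>The maximum with 0 makes \<open>t\<close> positive, so
      \<open>inverse t\<close> is a radius, larger than s. Its admissibility contradicts the choice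
      of s.\<close>
    obtain t where t: "max (mat_op_norm K) 0 < t" "t < inverse s"
      using dense[of "max (mat_op_norm K) 0" "inverse s"] less s by auto
    define r where "r = inverse t"
    have rs: "r > s" "r > 0" using t s by (auto simp: r_def field_simps)
    have "stable_upto p r"
      unfolding stable_upto_def
    proof (intro conjI allI impI)
      fix z w assume zw: "cmod z < r" "cmod w < r"
      show "bipoly p z w \<noteq> 0"
      proof
        let ?Z = "Z_mat n1 n2 z w"
        have Z: "?Z \<in> carrier_mat ?N ?N" by (simp add: Z_mat_eq)
        have KZ: "K * ?Z \<in> carrier_mat ?N ?N" using K Z by simp
        assume "bipoly p z w = 0"
        then have "Determinant.det (1\<^sub>m ?N - K * ?Z) = 0" by (simp add: repK)
        \<comment> \<open>A zero of the determinant yields a nonzero v = K Z v, whose norm is at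
          most t max(|z|,|w|) times itself; this factor is below 1 on the bidisk of radius
          1/t.\<close>
        then obtain v where v: "v \<in> carrier_vec ?N" "v \<noteq> 0\<^sub>v ?N" "(1\<^sub>m ?N - K * ?Z) *\<^sub>v v = 0\<^sub>v ?N"
          using det_0_iff_vec_prod_zero[OF minus_carrier_mat[OF KZ]] by blast
        have "v = K *\<^sub>v (?Z *\<^sub>v v)"
        proof -
          have "v - (K * ?Z) *\<^sub>v v = 0\<^sub>v ?N"
            using v KZ by (simp add: minus_mult_distrib_mat_vec[of _ ?N ?N])
          then have "v $ i = ((K * ?Z) *\<^sub>v v) $ i" if "i < ?N" for i
            using that v KZ K by (metis carrier_matD(1) dim_mult_mat_vec eq_iff_diff_eq_0 index_minus_vec(1) index_zero_vec(1))
          then have "v = (K * ?Z) *\<^sub>v v" using v KZ K by (intro eq_vecI) auto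
          then show ?thesis using assoc_mult_mat_vec[OF K Z v(1)] by simp
        qed
        then have "euclidean_norm v \<le> mat_op_norm K * euclidean_norm (?Z *\<^sub>v v)"
          using op[of "?Z *\<^sub>v v"] Z v(1) by simp
        also have "\<dots> \<le> t * euclidean_norm (?Z *\<^sub>v v)" using t by (intro mult_right_mono) auto
        also have "euclidean_norm (?Z *\<^sub>v v) \<le> max (cmod z) (cmod w) * euclidean_norm v"
        proof (rule power2_le_imp_le)
          have "(?Z *\<^sub>v v) $ i = (if i < n1 then z else w) * (v $ i)" if i: "i < ?N" for i
          proof -
            have "(?Z *\<^sub>v v) $ i = (\<Sum>j = 0..<?N. ?Z $$ (i, j) * v $ j)"
              using i v(1) by (simp add: Z_mat_eq scalar_prod_def)
            also have "\<dots> = (\<Sum>j = 0..<?N. if j = i then (if i < n1 then z else w) * v $ i else 0)"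
              using i by (intro sum.cong) (auto simp: Z_mat_eq)
            finally have "(?Z *\<^sub>v v) $ i = \<dots>" .
            then show ?thesis using i by simp
          qed
          then have "(euclidean_norm (?Z *\<^sub>v v))\<^sup>2 = (\<Sum>i<?N. (cmod ((if i < n1 then z else w) * (v $ i)))\<^sup>2)"
            using Z unfolding euclidean_norm_sq by (intro sum.cong) auto
          also have "\<dots> \<le> (\<Sum>i<?N. (max (cmod z) (cmod w) * cmod (v $ i))\<^sup>2)"
            by (intro sum_mono power_mono) (auto simp: norm_mult intro!: mult_right_mono)
          also have "\<dots> = (max (cmod z) (cmod w) * euclidean_norm v)\<^sup>2"
            using v(1) by (simp add: power_mult_distrib euclidean_norm_sq sum_distrib_left)
          finally show "(euclidean_norm (?Z *\<^sub>v v))\<^sup>2 \<le> (max (cmod z) (cmod w) * euclidean_norm v)\<^sup>2" .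
        qed (auto simp: le_max_iff_disj)
        finally have "euclidean_norm v \<le> (t * max (cmod z) (cmod w)) * euclidean_norm v"
          using t by (simp add: mult.assoc mult_left_mono)
        moreover have "t * max (cmod z) (cmod w) < 1"
        proof -
          have "t * max (cmod z) (cmod w) < t * r" using zw t by (intro mult_strict_left_mono) auto
          then show ?thesis using t by (simp add: r_def)
        qed
        ultimately show False
          using euclidean_norm_pos[OF v(1,2)] by (simp add: mult_le_cancel_right1)
      qed
    qed (use rs in simp)
    then show False using greatest rs by force
  qed
  then have "mat_op_norm K = inverse s" using le by simp
  then show ?thesis using K repK by (auto simp: s_def)
qed

end
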